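(* Let $\alpha_1,\alpha_2,\alpha_3\in\mathbb S^1\setminus\Omega$ be parameters, let $\sigma_1,\sigma_2,\sigma_3\in\{-1,1\}$ be signs at most one of which is positive, and let $\tau\in\mathbb C$. Let $p_1,p_2,p_3$ and $q_1,q_2,q_3$ be strongly regular triples with respect to the same $\pmb\alpha=(\alpha_1,\alpha_2,\alpha_3)$, $\pmb\sigma=(\sigma_1,\sigma_2,\sigma_3)$, $\tau$. Assume that $R_{\alpha_3}^{p_3}R_{\alpha_2}^{p_2}R_{\alpha_1}^{p_1}$ and $R_{\alpha_3}^{q_3}R_{\alpha_2}^{q_2}R_{\alpha_1}^{q_1}$ are in the same $\mathrm{SU}(2,1)$-conjugacy class. If at least one of $R_{\alpha_3}^{p_3}R_{\alpha_2}^{p_2}$, $R_{\alpha_2}^{p_2}R_{\alpha_1}^{p_1}$ and at least one of $R_{\alpha_3}^{q_3}R_{\alpha_2}^{q_2}$, $R_{\alpha_2}^{q_2}R_{\alpha_1}^{q_1}$ is loxodromic, then these triples can be connected, modulo conjugacy, by finitely many bendings.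
   Context: Let $V$ be a 3-dimensional complex vector space with a Hermitian form $\langle-,-\rangle$ (linear in the first argument) of signature $++-$. The same letter denotes a point of $\mathbb PV$ and a representative. A point $p$ has signature $\sigma p\in\{-1,0,1\}$, the sign of $\langle p,p\rangle$ (negative, isotropic, positive). $\mathrm{SU}(2,1)$ is the group of determinant $1$ linear automorphisms of $V$ preserving the form; its elements are called isometries and their fixed points are the points of $\mathbb PV$ given by eigenvectors. $\mathbb S^1\subset\mathbb C$ is the unit circle and $\Omega$ the set of cube roots of unity. For nonisotropic $p$ and $\alpha\in\mathbb S^1$, $R_\alpha^p:x\mapsto(\alpha^{-2}-\alpha)\frac{\langle x,p\rangle}{\langle p,p\rangle}p+\alpha x$. An isometry is loxodromic if it has no negative fixed point and exactly two isotropic fixed points. A triple $p_1,p_2,p_3$ of nonisotropic points is strongly regular with respect to $\pmb\alpha,\pmb\sigma,\tau$ if $\sigma p_i=\sigma_i$; the points are pairwise distinct; $p_2$ is orthogonal neither to $p_1$ nor to $p_3$; the points are not in a same complex projective line; and $\mathrm{tr}\,R_{\alpha_3}^{p_3}R_{\alpha_2}^{p_2}R_{\alpha_1}^{p_1}=\tau$. Bendings. For distinct nonisotropic nonorthogonal $p,q$ spanning a noneuclidean complex line $L$ (the form restricted to the corresponding $2$-dimensional subspace is nondegenerate) and parameters $\alpha,\beta$, let $R=R_\beta^qR_\alpha^p$ and let $c$ be the polar point of $L$ (the point orthogonal to $L$). The bending subgroup $B:\mathbb R\to\mathrm{SU}(2,1)$ of $R$, which commutes with $R$, is: if $R$ is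 elliptic (has a negative fixed point), with fixed points $x,\tilde x\in L$, $\langle x,\tilde x\rangle=0$, then $B(s)=\mathrm{diag}(1,e^{is/2},e^{-is/2})$ in the basis $c,x,\tilde x$; if $R$ is loxodromic with isotropic fixed points $v_1,v_2$, then $B(s)=\mathrm{diag}(1,e^s,e^{-s})$ in the basis $c,v_1,v_2$; if $R$ is parabolic (no negative and a single isotropic fixed point $v_1\in L$), choose an isotropic $v_2\in L$, $v_2\ne v_1$, with representatives such that $\langle v_1,v_2\rangle\in\mathbb R$, and let $B(s)c=c$, $B(s)v_1=v_1$, $B(s)v_2=isv_1+v_2$. A bending of a triple $p_1,p_2,p_3$ replaces it by $B(s)p_1,B(s)p_2,p_3$, where $B$ is the bending subgroup of $R_{\alpha_2}^{p_2}R_{\alpha_1}^{p_1}$, or by $p_1,B(s)p_2,B(s)p_3$, where $B$ is that of $R_{\alpha_3}^{p_3}R_{\alpha_2}^{p_2}$, for some $s\in\mathbb R$; it preserves the product $R_{\alpha_3}^{p_3}R_{\alpha_2}^{p_2}R_{\alpha_1}^{p_1}$. Two triples are connected modulo conjugacy by finitely many bendings if a finite sequence of bendings takes the first one to $Iq_1,Iq_2,Iq_3$ for some $I\in\mathrm{SU}(2,1)$, where $q_1,q_2,q_3$ is the second one. *)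

theory Defs
  imports "HOL-Analysis.Analysis"
begin

text \<open>
  The vector space is \<open>complex ^ 3\<close>, carrying an arbitrary Hermitian form \<open>h\<close> of signature
  \<open>++-\<close>.  Points of the projective plane are given by nonzero representatives;
  equality of points is \<open>same_point\<close>.
\<close>

type_synonym cvec = "complex ^ 3"
type_synonym cmat = "complex ^ 3 ^ 3"
type_synonym form = "cvec \<Rightarrow> cvec \<Rightarrow> complex"
type_synonym triple = "cvec \<times> cvec \<times> cvec"

definition hermitian_form :: "form \<Rightarrow> bool" where
  "hermitian_form h \<longleftrightarrow>
     (\<forall>x y z a b. h (a *s x + b *s y) z = a * h x z + b * h y z) \<and>
     (\<forall>x y. h y x = cnj (h x y))"

text \<open>Orthogonality and the signs make \<open>e1, e2, e3\<close> a basis.\<close>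

definition signature_ppm :: "form \<Rightarrow> bool" where
  "signature_ppm h \<longleftrightarrow>
     (\<exists>e1 e2 e3. h e1 e2 = 0 \<and> h e1 e3 = 0 \<and> h e2 e3 = 0 \<and>
        Re (h e1 e1) > 0 \<and> Re (h e2 e2) > 0 \<and> Re (h e3 e3) < 0)"

definition same_point :: "cvec \<Rightarrow> cvec \<Rightarrow> bool" where
  "same_point x y \<longleftrightarrow> (\<exists>k. k \<noteq> 0 \<and> y = k *s x)"

definition sig :: "form \<Rightarrow> cvec \<Rightarrow> real" where
  "sig h x = sgn (Re (h x x))"

definition SU :: "form \<Rightarrow> cmat set" where
  "SU h = {A. det A = 1 \<and> (\<forall>x y. h (A *v x) (A *v y) = h x y)}"

definition SU_conjugate :: "form \<Rightarrow> cmat \<Rightarrow> cmat \<Rightarrow> bool" where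
  "SU_conjugate h A A' \<longleftrightarrow> (\<exists>I \<in> SU h. A' = I ** A ** matrix_inv I)"

definition fixed_point :: "cmat \<Rightarrow> cvec \<Rightarrow> bool" where
  "fixed_point A x \<longleftrightarrow> x \<noteq> 0 \<and> (\<exists>k. A *v x = k *s x)"

definition elliptic :: "form \<Rightarrow> cmat \<Rightarrow> bool" where
  "elliptic h A \<longleftrightarrow> (\<exists>x. fixed_point A x \<and> sig h x = -1)"

definition loxodromic :: "form \<Rightarrow> cmat \<Rightarrow> bool" where
  "loxodromic h A \<longleftrightarrow>
     \<not> (\<exists>x. fixed_point A x \<and> sig h x = -1) \<and>
     (\<exists>v w. fixed_point A v \<and> sig h v = 0 \<and> fixed_point A w \<and> sig h w = 0 \<and>
        \<not> same_point v w \<and>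
        (\<forall>u. fixed_point A u \<and> sig h u = 0 \<longrightarrow> same_point v u \<or> same_point w u))"

definition parabolic :: "form \<Rightarrow> cmat \<Rightarrow> bool" where
  "parabolic h A \<longleftrightarrow>
     \<not> (\<exists>x. fixed_point A x \<and> sig h x = -1) \<and>
     (\<exists>v. fixed_point A v \<and> sig h v = 0 \<and>
        (\<forall>u. fixed_point A u \<and> sig h u = 0 \<longrightarrow> same_point v u))"

definition \<Omega> :: "complex set" where
  "\<Omega> = {z. z ^ 3 = 1}"

definition R :: "form \<Rightarrow> complex \<Rightarrow> cvec \<Rightarrow> cmat" where
  "R h \<alpha> p = matrix (\<lambda>x. ((inverse \<alpha> ^ 2 - \<alpha>) * (h x p / h p p)) *s p + \<alpha> *s x)"

lemma R_apply:
  assumes "hermitian_form h"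
  shows "R h \<alpha> p *v x = ((inverse \<alpha> ^ 2 - \<alpha>) * (h x p / h p p)) *s p + \<alpha> *s x"
proof -
  have add: "h (x + y) z = h x z + h y z" for x y z
    using assms[unfolded hermitian_form_def, THEN conjunct1, rule_format, of 1 x 1 y z] by simp
  have scale: "h (a *s x) z = a * h x z" for a x z
    using assms[unfolded hermitian_form_def, THEN conjunct1, rule_format, of a x 0 x z] by simp
  have "Vector_Spaces.linear (*s) (*s)
          (\<lambda>x. ((inverse \<alpha> ^ 2 - \<alpha>) * (h x p / h p p)) *s p + \<alpha> *s x)"
    by unfold_locales
      (simp_all add: add scale vec_eq_iff algebra_simps add_divide_distrib diff_divide_distrib)
  then show ?thesis
    unfolding R_def by (rule matrix_works)
qed

text \<open>A complex projective line is the projectivization of a two-dimensional subspace.\<close>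

definition complex_line :: "cvec set \<Rightarrow> bool" where
  "complex_line L \<longleftrightarrow> vec.subspace L \<and> vec.dim L = 2"

definition noneuclidean :: "form \<Rightarrow> cvec set \<Rightarrow> bool" where
  "noneuclidean h L \<longleftrightarrow> (\<forall>x\<in>L. (\<forall>y\<in>L. h x y = 0) \<longrightarrow> x = 0)"

definition polar_point :: "form \<Rightarrow> cvec set \<Rightarrow> cvec \<Rightarrow> bool" where
  "polar_point h L c \<longleftrightarrow> c \<noteq> 0 \<and> (\<forall>x\<in>L. h x c = 0)"

definition strongly_regular ::
  "form \<Rightarrow> complex \<times> complex \<times> complex \<Rightarrow> real \<times> real \<times> real \<Rightarrow> complex \<Rightarrow> triple \<Rightarrow> bool" where
  "strongly_regular h = (\<lambda>(\<alpha>1, \<alpha>2, \<alpha>3) (\<sigma>1, \<sigma>2, \<sigma>3) \<tau> (p1, p2, p3).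
     h p1 p1 \<noteq> 0 \<and> h p2 p2 \<noteq> 0 \<and> h p3 p3 \<noteq> 0 \<and>
     sig h p1 = \<sigma>1 \<and> sig h p2 = \<sigma>2 \<and> sig h p3 = \<sigma>3 \<and>
     \<not> same_point p1 p2 \<and> \<not> same_point p1 p3 \<and> \<not> same_point p2 p3 \<and>
     h p2 p1 \<noteq> 0 \<and> h p2 p3 \<noteq> 0 \<and>
     \<not> (\<exists>L. complex_line L \<and> {p1, p2, p3} \<subseteq> L) \<and>
     trace (R h \<alpha>3 p3 ** R h \<alpha>2 p2 ** R h \<alpha>1 p1) = \<tau>)"

text \<open>
  \<open>bending_subgroup h \<alpha> \<beta> p q B\<close> says that \<open>B\<close> is a bending subgroup of
  \<open>R h \<beta> q ** R h \<alpha> p\<close>.  This is a relation because the parametrization is fixed only up to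
  choices: the order of the two fixed points and, in the parabolic case, the vector \<open>v2\<close> and the
  scaling of \<open>v1\<close>.
\<close>

definition bending_subgroup ::
  "form \<Rightarrow> complex \<Rightarrow> complex \<Rightarrow> cvec \<Rightarrow> cvec \<Rightarrow> (real \<Rightarrow> cmat) \<Rightarrow> bool" where
  "bending_subgroup h \<alpha> \<beta> p q B \<longleftrightarrow>
     h p p \<noteq> 0 \<and> h q q \<noteq> 0 \<and> \<not> same_point p q \<and> h p q \<noteq> 0 \<and>
     (let L = vec.span {p, q}; A = R h \<beta> q ** R h \<alpha> p in
      noneuclidean h L \<and>
      (\<exists>c. polar_point h L c \<and> (\<forall>s. B s *v c = c) \<and>
        (elliptic h A \<and>
           (\<exists>x\<in>L. \<exists>x'\<in>L. fixed_point A x \<and> fixed_point A x' \<and>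
              \<not> same_point x x' \<and> h x x' = 0 \<and>
              (\<forall>s. B s *v x = exp (\<i> * of_real s / 2) *s x \<and>
                   B s *v x' = exp (- (\<i> * of_real s / 2)) *s x'))
         \<or> loxodromic h A \<and>
           (\<exists>v1 v2. fixed_point A v1 \<and> sig h v1 = 0 \<and> fixed_point A v2 \<and> sig h v2 = 0 \<and>
              \<not> same_point v1 v2 \<and>
              (\<forall>s. B s *v v1 = exp (of_real s) *s v1 \<and>
                   B s *v v2 = exp (- of_real s) *s v2))
         \<or> parabolic h A \<and>
           (\<exists>v1\<in>L. \<exists>v2\<in>L. fixed_point A v1 \<and> sig h v1 = 0 \<and>
              v2 \<noteq> 0 \<and> sig h v2 = 0 \<and> \<not> same_point v1 v2 \<and> h v1 v2 \<in> \<real> \<and>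
              (\<forall>s. B s *v v1 = v1 \<and>
                   B s *v v2 = (\<i> * of_real s) *s v1 + v2)))))"

inductive bending :: "form \<Rightarrow> complex \<times> complex \<times> complex \<Rightarrow> triple \<Rightarrow> triple \<Rightarrow> bool"
  for h \<alpha> where
  bend12: "\<alpha> = (\<alpha>1, \<alpha>2, \<alpha>3) \<Longrightarrow> bending_subgroup h \<alpha>1 \<alpha>2 p1 p2 B \<Longrightarrow>
    bending h \<alpha> (p1, p2, p3) (B s *v p1, B s *v p2, p3)"
| bend23: "\<alpha> = (\<alpha>1, \<alpha>2, \<alpha>3) \<Longrightarrow> bending_subgroup h \<alpha>2 \<alpha>3 p2 p3 B \<Longrightarrow>
    bending h \<alpha> (p1, p2, p3) (p1, B s *v p2, B s *v p3)"

definition connected_by_bendings ::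
  "form \<Rightarrow> complex \<times> complex \<times> complex \<Rightarrow> triple \<Rightarrow> triple \<Rightarrow> bool" where
  "connected_by_bendings h \<alpha> = (\<lambda>p (q1, q2, q3).
     \<exists>r1 r2 r3. \<exists>I \<in> SU h. (bending h \<alpha>)\<^sup>*\<^sup>* p (r1, r2, r3) \<and>
       same_point (I *v q1) r1 \<and> same_point (I *v q2) r2 \<and> same_point (I *v q3) r3)"

end

theory Submission
  imports Defs
begin

text \<open>
  Write \<open>x = ta(p1, p2)\<close>, \<open>y = ta(p2, p3)\<close> for the tances
  \<open>|h p q|\<^sup>2 / |h p p * h q q|\<close>.  A bending of the first two points keeps \<open>x\<close> and, modulo isometry,
  moves \<open>p3\<close> along an orbit of the one-parameter group.  Decompose \<open>p3 = u + w c\<close> with respect to the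
  line \<open>L\<close> of \<open>p1, p2\<close>; the trace fixes \<open>h (A p3) p3\<close> for \<open>A = R2 R1\<close>, and this one complex equation
  determines \<open>u\<close> up to a phase and the bending flow as soon as \<open>u\<close> is not isotropic.  Hence the triples
  with a given \<open>x\<close> form a single orbit if \<open>p3\<close> is negative; likewise for given \<open>y\<close> if \<open>p1\<close> is negative,
  and at least one of these holds.  If \<open>A\<close> is loxodromic, its bendings make \<open>y\<close> arbitrarily large,
  and a large tance forces the corresponding product to be loxodromic.  So, when \<open>p1\<close> is negative, both triples can be
  bent to a common large value of \<open>y\<close>, where they are joined by one more bending.
\<close>

section \<open>Frames and isometries\<close>

text \<open>The sign of the third point matters because \<open>h p3 p3 = h u u + |w|^2\<close> for
  the normalised polar vector \<open>c\<close>: a negative \<open>p3\<close> forces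
  \<open>h u u < 0\<close>. For a positive \<open>p3\<close> the part \<open>u\<close> may be
  isotropic, and one level of the tance may then split into several orbits, so the argument has to
  use an end of the triple that is negative. The complex equation arises because \<open>R\<close> is
  a scalar plus a map of rank one: its trace against \<open>A\<close> leaves
  \<open>h (A p3) p3\<close>. Removing the contribution of \<open>c\<close> gives
  \<open>h (A u) u - \<alpha>1 * \<alpha>2 * h u u\<close>, whose two real parts fix the invariants
  of \<open>u\<close> under phases and flow, since the eigenvalue of \<open>A\<close> at
  \<open>c\<close> differs from those on the line. A large tance forces a loxodromic product because
  the trace of \<open>A\<close> on the line is affine in the tance, while an eigenvalue of modulus
  one would bound that trace. If \<open>p1\<close> is negative and only \<open>R3 R2\<close> is
  loxodromic, its bendings first raise \<open>x\<close> until \<open>R2 R1\<close> is loxodromic as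
  well; then \<open>y\<close> can be raised.\<close>

definition isometry :: "form \<Rightarrow> cmat \<Rightarrow> bool" where
  "isometry h M \<longleftrightarrow> (\<forall>x y. h (M *v x) (M *v y) = h x y)"

text \<open>Linear independence of an ordered triple. Explicit coefficients, unlike independence of
  the set \<open>{a, b, c}\<close>, also exclude repeated vectors.\<close>

definition frame :: "cvec \<Rightarrow> cvec \<Rightarrow> cvec \<Rightarrow> bool" where
  "frame a b c \<longleftrightarrow> (\<forall>i j k. i *s a + j *s b + k *s c = 0 \<longrightarrow> i = 0 \<and> j = 0 \<and> k = 0)"

lemma frame_matrix:
  assumes "frame a b c"
  obtains M N :: cmat where "M ** N = mat 1" "N ** M = mat 1"
    "\<And>x :: cvec. M *v x = x $ 1 *s a + x $ 2 *s b + x $ 3 *s c"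
proof -
  define M :: cmat where
    "M = (\<chi> i. vector [a $ i, b $ i, c $ i])"
  have M: "M *v x = x $ 1 *s a + x $ 2 *s b + x $ 3 *s c" for x
    by (simp add: M_def matrix_vector_mult_def sum_3 vec_eq_iff mult.commute)
  have "x = 0" if "M *v x = 0" for x
  proof -
    have "x $ 1 = 0 \<and> x $ 2 = 0 \<and> x $ 3 = 0"
      using assms that unfolding frame_def M by blast
    then show ?thesis
      by (simp add: vec_eq_iff forall_3)
  qed
  then obtain N where "N ** M = mat 1"
    using matrix_left_invertible_ker by blast
  then show ?thesis
    using M matrix_left_right_inverse that by blast
qed

lemma frame_span:
  assumes "frame a b c"
  obtains i j k where "x = i *s a + j *s b + k *s c"
proof -
  obtain M N :: cmat where MN: "M ** N = mat 1"
    and M: "\<And>x :: cvec. M *v x = x $ 1 *s a + x $ 2 *s b + x $ 3 *s c"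
    using frame_matrix[OF assms] by metis
  have "x = M *v (N *v x)"
    by (simp add: MN matrix_vector_mul_assoc)
  then show ?thesis
    using that M by metis
qed

lemma frame_matrix_eqI:
  fixes M N :: cmat
  assumes "frame a b c" "M *v a = N *v a" "M *v b = N *v b" "M *v c = N *v c"
  shows "M = N"
proof -
  have "M *v x = N *v x" for x
  proof -
    obtain i j k where "x = i *s a + j *s b + k *s c"
      using frame_span assms(1) by blast
    then show ?thesis
      by (simp add: assms matrix_vector_right_distrib vector_scalar_commute)
  qed
  then show ?thesis
    by (simp add: matrix_eq)
qed

lemma frame_rotate: "frame a b c \<Longrightarrow> frame b c a"
proof -
  assume "frame a b c"
  moreover have "i *s b + j *s c + k *s a = k *s a + i *s b + j *s c" for i j k
    by (simp add: ac_simps)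
  ultimately show ?thesis
    unfolding frame_def by metis
qed

lemma isometry_mult: "isometry h M \<Longrightarrow> isometry h N \<Longrightarrow> isometry h (M ** N)"
  by (simp add: isometry_def flip: matrix_vector_mul_assoc)

lemma det_cnj: "det (\<chi> i j. cnj (M $ i $ j)) = cnj (det (M :: cmat))"
  by (simp add: det_3)

locale hermitian =
  fixes h :: form
  assumes herm: "hermitian_form h"
begin

lemma h_cnj: "h y x = cnj (h x y)"
  using herm unfolding hermitian_form_def by blast

lemma h_add_left: "h (x + y) z = h x z + h y z"
  using herm[unfolded hermitian_form_def, THEN conjunct1, rule_format, of 1 x 1 y z] by simp

lemma h_scale_left: "h (a *s x) z = a * h x z"
  using herm[unfolded hermitian_form_def, THEN conjunct1, rule_format, of a x 0 x z] by simp

lemma h_add_right: "h z (x + y) = h z x + h z y"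
  by (metis h_cnj h_add_left complex_cnj_add)

lemma h_scale_right: "h z (a *s x) = cnj a * h z x"
  by (metis h_cnj h_scale_left complex_cnj_mult)

lemma h_zero_left: "h 0 z = 0"
  using h_scale_left[of 0 0 z] by simp

lemma h_zero_right: "h z 0 = 0"
  using h_scale_right[of z 0 0] by simp

lemma h_diff_left: "h (x - y) z = h x z - h y z"
  using h_add_left[of "x - y" y z] by simp

lemma h_diff_right: "h z (x - y) = h z x - h z y"
  using h_add_right[of z "x - y" y] by simp

lemmas h_simps = h_add_left h_add_right h_scale_left h_scale_right h_zero_left h_zero_right
  h_diff_left h_diff_right

lemma h_self: "h x x = of_real (Re (h x x))"
  using h_cnj[of x x] by (metis Reals_cnj_iff of_real_Re)

lemma h_sym_zero: "h x y = 0 \<Longrightarrow> h y x = 0"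
  using h_cnj[of y x] by simp

text \<open>A Gram matrix determines a frame up to isometry: \<open>N\<close> takes coordinates in
  the first frame and \<open>K\<close> rebuilds the vector from the second.\<close>

lemma frame_isometry:
  assumes "frame a b c"
    and "h a' a' = h a a" "h b' b' = h b b" "h c' c' = h c c"
      "h a' b' = h a b" "h a' c' = h a c" "h b' c' = h b c"
  obtains I where "isometry h I" "I *v a = a'" "I *v b = b'" "I *v c = c'"
proof -
  obtain M N :: cmat where MN: "M ** N = mat 1" "N ** M = mat 1"
    and M: "\<And>x :: cvec. M *v x = x $ 1 *s a + x $ 2 *s b + x $ 3 *s c"
    using frame_matrix[OF assms(1)] by metis
  define K :: cmat where
    "K = (\<chi> i. vector [a' $ i, b' $ i, c' $ i])"
  have K: "K *v x = x $ 1 *s a' + x $ 2 *s b' + x $ 3 *s c'" for x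
    by (simp add: K_def matrix_vector_mult_def sum_3 vec_eq_iff mult.commute)
  have sym: "h b' a' = h b a" "h c' a' = h c a" "h c' b' = h c b"
    using assms by (metis h_cnj)+
  have KM: "h (K *v x) (K *v y) = h (M *v x) (M *v y)" for x y
    by (simp add: K M h_simps assms sym)
  have KN: "(K ** N) *v (M *v x) = K *v x" for x
    by (simp add: MN flip: matrix_vector_mul_assoc) (simp add: matrix_vector_mul_assoc MN)
  have "isometry h (K ** N)"
    unfolding isometry_def
  proof (intro allI)
    fix x y
    show "h ((K ** N) *v x) ((K ** N) *v y) = h x y"
      using KM[of "N *v x" "N *v y"] by (simp add: matrix_vector_mul_assoc MN)
  qed
  moreover have "M *v axis 1 1 = a" "M *v axis 2 1 = b" "M *v axis 3 1 = c"
    "K *v axis 1 1 = a'" "K *v axis 2 1 = b'" "K *v axis 3 1 = c'"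
    by (simp_all add: M K axis_def)
  ultimately show ?thesis
    using that KN by metis
qed

lemma R_apply': "R h \<alpha> p *v x = ((inverse \<alpha> ^ 2 - \<alpha>) * (h x p / h p p)) *s p + \<alpha> *s x"
  by (rule R_apply[OF herm])

text \<open>\<open>R\<close> is \<alpha> times the identity plus a rank-one map, and the trace of a
  rank-one map composed with \<open>M\<close> is a value of the form. This turns the trace condition
  on a triple into an equation for its third point.\<close>

lemma trace_R_mult:
  "trace (R h \<alpha> p ** M) = (inverse \<alpha> ^ 2 - \<alpha>) * (h (M *v p) p / h p p) + \<alpha> * trace M"
proof -
  have entry: "A $ i $ j = (A *v axis j 1) $ i" for A :: cmat and i j
    by (simp add: matrix_vector_mult_def axis_def if_distrib cong: if_cong)
  have expand: "p = (\<Sum>i\<in>UNIV. p $ i *s axis i 1)"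
    by (simp add: basis_expansion)
  have "h (M *v p) p = (\<Sum>i\<in>UNIV. p $ i * h (M *v axis i 1) p)"
    by (subst (1) expand) (simp add: sum_3 h_simps matrix_vector_right_distrib vector_scalar_commute)
  moreover have "(R h \<alpha> p ** M) $ i $ i = (inverse \<alpha> ^ 2 - \<alpha>) / h p p * (p $ i * h (M *v axis i 1) p) + \<alpha> * M $ i $ i" for i
    by (subst (1 2) entry) (simp add: R_apply' flip: matrix_vector_mul_assoc)
  ultimately show ?thesis
    by (simp add: trace_def sum_3 distrib_left add_divide_distrib)
qed

end

section \<open>Bendings and isometries\<close>

lemma same_point_mult:
  assumes "J ** I = mat 1"
  shows "same_point (I *v x) (I *v y) \<longleftrightarrow> same_point x y"
proof -
  have "J *v (I *v z) = z" for z
    by (simp add: matrix_vector_mul_assoc assms)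
  then show ?thesis
    unfolding same_point_def by (metis vector_scalar_commute)
qed

lemma same_point_scale:
  assumes "k1 \<noteq> 0" "k2 \<noteq> 0"
  shows "same_point (k1 *s x) (k2 *s y) \<longleftrightarrow> same_point x y"
proof
  assume "same_point (k1 *s x) (k2 *s y)"
  then obtain k where k: "k \<noteq> 0" "k2 *s y = k *s (k1 *s x)"
    unfolding same_point_def by blast
  have "y = inverse k2 *s (k2 *s y)"
    using assms by simp
  also have "\<dots> = (inverse k2 * k * k1) *s x"
    by (simp add: k mult.assoc)
  finally show "same_point x y"
    unfolding same_point_def using assms k(1) by (metis inverse_nonzero_iff_nonzero mult_eq_0_iff)
next
  assume "same_point x y"
  then obtain k where k: "k \<noteq> 0" "y = k *s x"
    unfolding same_point_def by blast
  then have "k2 *s y = (k2 * k / k1) *s (k1 *s x)"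
    using assms by simp
  then show "same_point (k1 *s x) (k2 *s y)"
    unfolding same_point_def using assms k(1) by (metis divide_eq_0_iff mult_eq_0_iff)
qed

lemma mem_span2: "x \<in> vec.span {p, q} \<longleftrightarrow> (\<exists>a b. x = a *s p + b *s q)"
  for x :: "complex ^ 'n"
  by (simp add: vec.span_insert vec.span_singleton) (metis add.commute diff_add_cancel add_diff_cancel)

lemma fixed_point_conj:
  assumes "J ** I = mat 1" "I ** J = mat 1"
  shows "fixed_point (I ** A ** J) (I *v x) \<longleftrightarrow> fixed_point A x"
proof -
  have J: "J *v (I *v z) = z" for z
    by (simp add: matrix_vector_mul_assoc assms)
  have "(I ** A ** J) *v (I *v x) = I *v (A *v x)"
    by (simp add: J flip: matrix_vector_mul_assoc)
  then show ?thesis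
    unfolding fixed_point_def
    by (metis J matrix_vector_mult_0_right vector_scalar_commute)
qed

text \<open>Each point gets its own scalar because representatives are rescaled
  independently.\<close>

fun act :: "cmat \<Rightarrow> complex \<times> complex \<times> complex \<Rightarrow> triple \<Rightarrow> triple" where
  "act I (k1, k2, k3) (p1, p2, p3) = (k1 *s (I *v p1), k2 *s (I *v p2), k3 *s (I *v p3))"

locale hermitian_ppm = hermitian +
  assumes signature: "signature_ppm h"
begin

section \<open>Consequences of the signature\<close>

lemma orthogonal_frame:
  assumes "h a b = 0" "h a c = 0" "h b c = 0" "h a a \<noteq> 0" "h b b \<noteq> 0" "h c c \<noteq> 0"
  shows "frame a b c"
  unfolding frame_def
proof (intro allI impI)
  fix i j k
  assume *: "i *s a + j *s b + k *s c = 0"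
  have "h (i *s a + j *s b + k *s c) x = 0" for x
    by (simp add: * h_zero_left)
  from this[of a] this[of b] this[of c] show "i = 0 \<and> j = 0 \<and> k = 0"
    using assms h_sym_zero by (auto simp: h_simps)
qed

text \<open>Law of inertia: otherwise the form would be nonpositive on the plane of \<open>x\<close>
  and \<open>n\<close>, which meets the positive definite plane orthogonal to
  \<open>e3\<close>.\<close>

lemma negative_perp_positive:
  assumes n: "Re (h n n) < 0" and x: "h x n = 0" "x \<noteq> 0"
  shows "Re (h x x) > 0"
proof (rule ccontr)
  assume neg: "\<not> Re (h x x) > 0"
  obtain e1 e2 e3 where e: "h e1 e2 = 0" "h e1 e3 = 0" "h e2 e3 = 0"
    "Re (h e1 e1) > 0" "Re (h e2 e2) > 0" "Re (h e3 e3) < 0"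
    using signature unfolding signature_ppm_def by blast
  have e': "h e2 e1 = 0" "h e3 e1 = 0" "h e3 e2 = 0"
    using e h_sym_zero by auto
  have fr: "frame e1 e2 e3"
    using e by (intro orthogonal_frame) auto
  have pos: "Re (h y y) \<ge> 0 \<and> (Re (h y y) = 0 \<longrightarrow> y = 0)" if "h y e3 = 0" for y
  proof -
    obtain i j k where y: "y = i *s e1 + j *s e2 + k *s e3"
      using fr by (rule frame_span)
    have "k = 0"
      using that e by (auto simp: y h_simps)
    then have "h y y = i * cnj i * h e1 e1 + j * cnj j * h e2 e2"
      by (simp add: y h_simps e e' algebra_simps)
    also have "\<dots> = of_real (cmod i ^ 2 * Re (h e1 e1) + cmod j ^ 2 * Re (h e2 e2))"
      by (simp add: complex_norm_square[symmetric] flip: h_self)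
    finally have *: "Re (h y y) = cmod i ^ 2 * Re (h e1 e1) + cmod j ^ 2 * Re (h e2 e2)"
      by simp
    have "cmod i ^ 2 * Re (h e1 e1) \<ge> 0" "cmod j ^ 2 * Re (h e2 e2) \<ge> 0"
      using e by auto
    with * show ?thesis
      using e \<open>k = 0\<close> by (auto simp: y add_nonneg_eq_0_iff)
  qed
  define a where "a = h n e3"
  define b where "b = h x e3"
  have "a \<noteq> 0"
    using pos[of n] n by (auto simp: a_def)
  \<comment> \<open>The combination of \<open>x\<close> and \<open>n\<close> orthogonal to
    \<open>e3\<close>. Since \<open>x\<close> and \<open>n\<close> are orthogonal and both
    nonpositive, \<open>h y y\<close> is nonpositive too, hence \<open>y = 0\<close>.\<close>
  define y where "y = a *s x - b *s n"
  have "h y e3 = 0"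
    by (simp add: y_def h_simps a_def b_def)
  have "h y y = a * cnj a * h x x + b * cnj b * h n n"
    using x h_sym_zero[OF x(1)] by (simp add: y_def h_simps algebra_simps)
  also have "\<dots> = of_real (cmod a ^ 2 * Re (h x x) + cmod b ^ 2 * Re (h n n))"
    by (simp add: complex_norm_square[symmetric] flip: h_self)
  finally have "Re (h y y) = cmod a ^ 2 * Re (h x x) + cmod b ^ 2 * Re (h n n)"
    by simp
  moreover have "cmod a ^ 2 * Re (h x x) \<le> 0" "cmod b ^ 2 * Re (h n n) \<le> 0"
    using n neg by (auto intro: mult_nonneg_nonpos)
  ultimately have "y = 0"
    using pos[OF \<open>h y e3 = 0\<close>] by linarith
  then have "h y n = 0"
    by (simp add: h_zero_left)
  then have "b = 0"
    using n x by (auto simp: y_def h_simps)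
  with \<open>y = 0\<close> \<open>a \<noteq> 0\<close> x show False
    by (simp add: y_def)
qed

text \<open>A nonzero vector of the radical would be orthogonal to a negative vector, hence
  positive, and yet isotropic.\<close>

lemma nondegenerate:
  assumes "\<And>y. h x y = 0"
  shows "x = 0"
proof (rule ccontr)
  assume "x \<noteq> 0"
  obtain n where "Re (h n n) < 0"
    using signature unfolding signature_ppm_def by blast
  then show False
    using negative_perp_positive[of n x] assms \<open>x \<noteq> 0\<close> by simp
qed

lemma isometry_inverse:
  assumes "isometry h I"
  obtains J where "I ** J = mat 1" "J ** I = mat 1" "isometry h J"
proof -
  have "x = 0" if "I *v x = 0" for x
    using assms that nondegenerate[of x] unfolding isometry_def by (metis h_zero_left)
  then obtain J where J: "J ** I = mat 1"
    using matrix_left_invertible_ker by blast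
  then have IJ: "I ** J = mat 1"
    by (simp add: matrix_left_right_inverse)
  have "isometry h J"
    using assms IJ unfolding isometry_def
    by (metis matrix_vector_mul_assoc matrix_vector_mul_lid)
  with J IJ show ?thesis
    using that by blast
qed

lemma R_scale: "k \<noteq> 0 \<Longrightarrow> R h \<alpha> (k *s p) = R h \<alpha> p"
  by (simp add: matrix_eq R_apply' h_simps)

lemma R_conj:
  assumes "isometry h I" "I ** J = mat 1" "J ** I = mat 1"
  shows "R h \<alpha> (I *v p) = I ** R h \<alpha> p ** J"
proof -
  have "R h \<alpha> (I *v p) *v x = (I ** R h \<alpha> p ** J) *v x" for x
  proof -
    have x: "I *v (J *v x) = x"
      by (simp add: matrix_vector_mul_assoc assms)
    have "h x (I *v p) = h (J *v x) p"
      using assms(1) x unfolding isometry_def by metis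
    moreover have "h (I *v p) (I *v p) = h p p"
      using assms(1) unfolding isometry_def by blast
    ultimately show ?thesis
      by (simp add: R_apply' matrix_vector_right_distrib vector_scalar_commute x
          flip: matrix_vector_mul_assoc)
  qed
  then show ?thesis
    by (simp add: matrix_eq)
qed

lemma
  assumes "isometry h I" "I ** J = mat 1" "J ** I = mat 1"
  shows elliptic_conj: "elliptic h A \<Longrightarrow> elliptic h (I ** A ** J)"
    and loxodromic_conj: "loxodromic h A \<Longrightarrow> loxodromic h (I ** A ** J)"
    and parabolic_conj: "parabolic h A \<Longrightarrow> parabolic h (I ** A ** J)"
proof -
  have ex: "(\<exists>x. P x) \<longleftrightarrow> (\<exists>x. P (I *v x))" and all: "(\<forall>x. P x) \<longleftrightarrow> (\<forall>x. P (I *v x))" for P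
    by (metis assms(2) matrix_vector_mul_assoc matrix_vector_mul_lid)+
  have sig: "sig h (I *v x) = sig h x" for x
    using assms(1) by (simp add: sig_def isometry_def)
  note rules = fixed_point_conj[OF assms(3,2)] same_point_mult[OF assms(3)] sig
  show "elliptic h A \<Longrightarrow> elliptic h (I ** A ** J)"
    unfolding elliptic_def by (subst ex) (simp add: rules)
  have 1: "(\<exists>x. fixed_point (I ** A ** J) x \<and> sig h x = - 1) \<longleftrightarrow> (\<exists>x. fixed_point A x \<and> sig h x = -1)"
    by (subst ex) (simp add: rules)
  have 2: "(\<forall>u. fixed_point (I ** A ** J) u \<and> sig h u = 0 \<longrightarrow> P u) \<longleftrightarrow>
      (\<forall>u. fixed_point A u \<and> sig h u = 0 \<longrightarrow> P (I *v u))" for P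
    by (subst all) (simp add: rules)
  show "loxodromic h A \<Longrightarrow> loxodromic h (I ** A ** J)"
    unfolding loxodromic_def 1 2 by (metis rules)
  show "parabolic h A \<Longrightarrow> parabolic h (I ** A ** J)"
    unfolding parabolic_def 1 2 by (metis rules)
qed

text \<open>Line, polar point, fixed points and their types are all carried along by
  \<open>I\<close>, while rescaling the points changes neither their span nor the reflections.
  Applied with \<open>I\<close> in the flow itself, it also supplies the bending back.\<close>

lemma bending_subgroup_act:
  assumes I: "isometry h I" "I ** J = mat 1" "J ** I = mat 1"
    and k: "k1 \<noteq> 0" "k2 \<noteq> 0"
    and B: "bending_subgroup h \<alpha> \<beta> p q B"
  shows "bending_subgroup h \<alpha> \<beta> (k1 *s (I *v p)) (k2 *s (I *v q)) (\<lambda>s. I ** B s ** J)"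
proof -
  define L where "L = vec.span {p, q}"
  define L' where "L' = vec.span {k1 *s (I *v p), k2 *s (I *v q)}"
  define A where "A = R h \<beta> q ** R h \<alpha> p"
  have hI: "h (I *v x) (I *v y) = h x y" for x y
    using I(1) by (simp add: isometry_def)
  have JI: "J *v (I *v x) = x" and IJ: "I *v (J *v x) = x" for x
    by (simp_all add: matrix_vector_mul_assoc I)
  have A': "R h \<beta> (k2 *s (I *v q)) ** R h \<alpha> (k1 *s (I *v p)) = I ** A ** J"
    using k by (simp add: R_scale R_conj[OF I] A_def)
      (metis I(3) matrix_mul_assoc matrix_mul_lid)
  have L': "x \<in> L' \<longleftrightarrow> J *v x \<in> L" for x
  proof -
    have "x \<in> L' \<longleftrightarrow> (\<exists>a b. x = I *v ((a * k1) *s p + (b * k2) *s q))"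
      unfolding L'_def mem_span2
      by (simp add: matrix_vector_right_distrib vector_scalar_commute)
    also have "\<dots> \<longleftrightarrow> (\<exists>a b. J *v x = (a * k1) *s p + (b * k2) *s q)"
      by (metis IJ JI)
    also have "\<dots> \<longleftrightarrow> (\<exists>a b. J *v x = a *s p + b *s q)"
      using k by (metis nonzero_eq_divide_eq)
    finally show ?thesis
      by (simp add: L_def mem_span2)
  qed
  have IL: "x \<in> L \<Longrightarrow> I *v x \<in> L'" for x
    by (simp add: L' JI)
  have sg: "sig h (I *v x) = sig h x" for x
    by (simp add: sig_def hI)
  note rules = fixed_point_conj[OF I(3,2)] same_point_mult[OF I(3)] sg hI
  have BI: "(I ** B s ** J) *v (I *v x) = I *v (B s *v x)" for s x
    by (simp add: JI flip: matrix_vector_mul_assoc)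
  note B = B[unfolded bending_subgroup_def Let_def, folded L_def A_def]
  have "h (k1 *s (I *v p)) (k1 *s (I *v p)) \<noteq> 0" "h (k2 *s (I *v q)) (k2 *s (I *v q)) \<noteq> 0"
    "h (k1 *s (I *v p)) (k2 *s (I *v q)) \<noteq> 0"
    "\<not> same_point (k1 *s (I *v p)) (k2 *s (I *v q))"
    using B k by (simp_all add: h_simps hI same_point_scale rules)
  moreover have "noneuclidean h L'"
    unfolding noneuclidean_def
  proof (intro ballI impI)
    fix x
    assume x: "x \<in> L'" and *: "\<forall>y\<in>L'. h x y = 0"
    have "h (J *v x) y = 0" if "y \<in> L" for y
      using *[rule_format, OF IL[OF that]] hI[of "J *v x" y] by (simp add: IJ)
    then have "J *v x = 0"
      using x B unfolding noneuclidean_def L' by blast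
    then show "x = 0"
      using IJ[of x] by simp
  qed
  moreover obtain c where c: "polar_point h L c" "\<forall>s. B s *v c = c"
    and cases: "elliptic h A \<and>
           (\<exists>x\<in>L. \<exists>x'\<in>L. fixed_point A x \<and> fixed_point A x' \<and>
              \<not> same_point x x' \<and> h x x' = 0 \<and>
              (\<forall>s. B s *v x = exp (\<i> * of_real s / 2) *s x \<and>
                   B s *v x' = exp (- (\<i> * of_real s / 2)) *s x'))
         \<or> loxodromic h A \<and>
           (\<exists>v1 v2. fixed_point A v1 \<and> sig h v1 = 0 \<and> fixed_point A v2 \<and> sig h v2 = 0 \<and>
              \<not> same_point v1 v2 \<and>
              (\<forall>s. B s *v v1 = exp (of_real s) *s v1 \<and>
                   B s *v v2 = exp (- of_real s) *s v2))
         \<or> parabolic h A \<and>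
           (\<exists>v1\<in>L. \<exists>v2\<in>L. fixed_point A v1 \<and> sig h v1 = 0 \<and>
              v2 \<noteq> 0 \<and> sig h v2 = 0 \<and> \<not> same_point v1 v2 \<and> h v1 v2 \<in> \<real> \<and>
              (\<forall>s. B s *v v1 = v1 \<and>
                   B s *v v2 = (\<i> * of_real s) *s v1 + v2))"
    (is "?E \<or> ?X \<or> ?P")
    using B by blast
  moreover have "polar_point h L' (I *v c)"
    unfolding polar_point_def
  proof (intro conjI ballI)
    show "I *v c \<noteq> 0"
      using c(1) JI[of c] unfolding polar_point_def by auto
    show "h x (I *v c) = 0" if "x \<in> L'" for x
      using c(1) that hI[of "J *v x" c] by (simp add: polar_point_def L' IJ)
  qed
  moreover have "\<forall>s. (I ** B s ** J) *v (I *v c) = I *v c"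
    using c(2) by (simp add: BI)
  moreover from cases have "elliptic h (I ** A ** J) \<and>
           (\<exists>x\<in>L'. \<exists>x'\<in>L'. fixed_point (I ** A ** J) x \<and> fixed_point (I ** A ** J) x' \<and>
              \<not> same_point x x' \<and> h x x' = 0 \<and>
              (\<forall>s. (I ** B s ** J) *v x = exp (\<i> * of_real s / 2) *s x \<and>
                   (I ** B s ** J) *v x' = exp (- (\<i> * of_real s / 2)) *s x'))
         \<or> loxodromic h (I ** A ** J) \<and>
           (\<exists>v1 v2. fixed_point (I ** A ** J) v1 \<and> sig h v1 = 0 \<and> fixed_point (I ** A ** J) v2 \<and> sig h v2 = 0 \<and>
              \<not> same_point v1 v2 \<and>
              (\<forall>s. (I ** B s ** J) *v v1 = exp (of_real s) *s v1 \<and>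
                   (I ** B s ** J) *v v2 = exp (- of_real s) *s v2))
         \<or> parabolic h (I ** A ** J) \<and>
           (\<exists>v1\<in>L'. \<exists>v2\<in>L'. fixed_point (I ** A ** J) v1 \<and> sig h v1 = 0 \<and>
              v2 \<noteq> 0 \<and> sig h v2 = 0 \<and> \<not> same_point v1 v2 \<and> h v1 v2 \<in> \<real> \<and>
              (\<forall>s. (I ** B s ** J) *v v1 = v1 \<and>
                   (I ** B s ** J) *v v2 = (\<i> * of_real s) *s v1 + v2))"
    (is "?E' \<or> ?X' \<or> ?P'")
  proof (elim disjE)
    assume E: ?E
    then obtain x x' where "x \<in> L" "x' \<in> L" "fixed_point A x" "fixed_point A x'"
      "\<not> same_point x x'" "h x x' = 0"
      "\<forall>s. B s *v x = exp (\<i> * of_real s / 2) *s x \<and>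
         B s *v x' = exp (- (\<i> * of_real s / 2)) *s x'"
      by blast
    then have ?E'
      using E elliptic_conj[OF I]
      by (intro conjI bexI[of _ "I *v x"] bexI[of _ "I *v x'"])
        (simp_all add: rules BI IL vector_scalar_commute)
    then show ?thesis by blast
  next
    assume X: ?X
    then obtain v1 v2 where "fixed_point A v1" "sig h v1 = 0" "fixed_point A v2" "sig h v2 = 0"
      "\<not> same_point v1 v2"
      "\<forall>s. B s *v v1 = exp (of_real s) *s v1 \<and> B s *v v2 = exp (- of_real s) *s v2"
      by blast
    then have ?X'
      using X loxodromic_conj[OF I]
      by (intro conjI exI[of _ "I *v v1"] exI[of _ "I *v v2"])
        (simp_all add: rules BI vector_scalar_commute)
    then show ?thesis by blast
  next
    assume P: ?P
    then obtain v1 v2 where "v1 \<in> L" "v2 \<in> L" "fixed_point A v1" "sig h v1 = 0" "v2 \<noteq> 0"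
      "sig h v2 = 0" "\<not> same_point v1 v2" "h v1 v2 \<in> \<real>"
      "\<forall>s. B s *v v1 = v1 \<and> B s *v v2 = (\<i> * of_real s) *s v1 + v2"
      by blast
    moreover from this have "I *v v2 \<noteq> 0"
      by (metis JI matrix_vector_mult_0_right)
    ultimately have ?P'
      using P parabolic_conj[OF I]
      by (intro conjI bexI[of _ "I *v v1"] bexI[of _ "I *v v2"])
        (simp_all add: rules BI IL vector_scalar_commute matrix_vector_right_distrib)
    then show ?thesis by blast
  qed
  ultimately show ?thesis
    unfolding bending_subgroup_def Let_def A' L'_def[symmetric] by blast
qed

lemma bending_act:
  assumes I: "isometry h I" and k: "k1 \<noteq> 0" "k2 \<noteq> 0" "k3 \<noteq> 0" and T: "bending h \<alpha> T S"
  shows "bending h \<alpha> (act I (k1, k2, k3) T) (act I (k1, k2, k3) S)"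
proof -
  obtain J where J: "I ** J = mat 1" "J ** I = mat 1"
    using isometry_inverse[OF I] by metis
  have JI: "J *v (I *v x) = x" for x
    by (simp add: matrix_vector_mul_assoc J)
  have eq: "(I ** M ** J) *v (k *s (I *v x)) = k *s (I *v (M *v x))" for M k x
    by (simp add: JI vector_scalar_commute flip: matrix_vector_mul_assoc)
  from T show ?thesis
  proof cases
    case (bend12 \<alpha>1 \<alpha>2 \<alpha>3 p1 p2 B p3 s)
    show ?thesis
      using bending.bend12[OF bend12(3) bending_subgroup_act[OF I J k(1,2) bend12(4)], of "k3 *s (I *v p3)" s]
      by (simp add: bend12 eq)
  next
    case (bend23 \<alpha>1 \<alpha>2 \<alpha>3 p2 p3 B p1 s)
    show ?thesis
      using bending.bend23[OF bend23(3) bending_subgroup_act[OF I J k(2,3) bend23(4)], of "k1 *s (I *v p1)" s]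
      by (simp add: bend23 eq)
  qed
qed

text \<open>Invariance of the Gram matrix \<open>H\<close> of the standard basis reads
  \<open>transpose M ** H ** C M = H\<close>; take determinants, \<open>det H\<close> being nonzero
  by nondegeneracy.\<close>

lemma isometry_cmod_det:
  assumes "isometry h M"
  shows "cmod (det M) = 1"
proof -
  define H :: cmat where "H = (\<chi> i j. h (axis i 1) (axis j 1))"
  define C :: "cmat \<Rightarrow> cmat" where "C = (\<lambda>M. \<chi> i j. cnj (M $ i $ j))"
  have expand: "x = (\<Sum>i\<in>UNIV. x $ i *s axis i 1)" for x :: cvec
    by (simp add: basis_expansion)
  have hH: "h x y = (\<Sum>i\<in>UNIV. \<Sum>j\<in>UNIV. x $ i * cnj (y $ j) * H $ i $ j)" for x y
    by (subst expand[of x], subst expand[of y]) (simp add: sum_3 h_simps H_def algebra_simps)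
  have "transpose M ** H ** C M = H"
  proof -
    have "(transpose M ** H ** C M) $ i $ j = h (M *v axis i 1) (M *v axis j 1)" for i j
    proof -
      have "(M *v axis i 1) $ k = M $ k $ i" for k i
        by (simp add: matrix_vector_mult_def axis_def if_distrib cong: if_cong)
      then show ?thesis
        by (subst hH) (simp add: matrix_matrix_mult_def transpose_def C_def sum_3 algebra_simps)
    qed
    then show ?thesis
      using assms by (simp add: vec_eq_iff isometry_def H_def)
  qed
  then have "det M * det H * cnj (det M) = det H"
    by (metis C_def det_cnj det_mul det_transpose)
  moreover have "det H \<noteq> 0"
  proof
    assume "det H = 0"
    then obtain x where x: "x \<noteq> 0" "x v* H = 0"
      by (metis det_transpose invertible_det_nz invertible_left_inverse
          matrix_left_invertible_ker transpose_matrix_vector)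
    have "h x y = (\<Sum>j\<in>UNIV. cnj (y $ j) * (x v* H) $ j)" for y
      by (subst hH) (simp add: vector_matrix_mult_def sum_3 algebra_simps)
    then show False
      using x nondegenerate by simp
  qed
  ultimately have "det M * cnj (det M) = 1"
    by (simp add: mult.commute mult.left_commute)
  then show ?thesis
    by (metis complex_mod_sqrt_Re_mult_cnj one_complex.sel(1) real_sqrt_one)
qed

text \<open>The scalar \<open>k\<close> is a unimodular cube root of the inverse determinant.
  Projectively, isometries of any determinant may therefore be used until the very end.\<close>

lemma isometry_SU:
  assumes "isometry h M"
  obtains I k where "I \<in> SU h" "k \<noteq> 0" "\<And>x. I *v x = k *s (M *v x)"
proof -
  obtain \<theta> where \<theta>: "det M = cis \<theta>"
    using isometry_cmod_det[OF assms] by (metis complex_norm_eq_1_exp cis_conv_exp)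
  define k where "k = cis (- \<theta> / 3)"
  define I :: cmat where "I = (\<chi> i j. k * M $ i $ j)"
  have I: "I *v x = k *s (M *v x)" for x
    by (simp add: I_def matrix_vector_mult_def vec_eq_iff sum_distrib_left mult.assoc)
  have "det I = k ^ 3 * det M"
    by (simp add: I_def det_3 power3_eq_cube algebra_simps)
  also have "\<dots> = 1"
    by (simp add: k_def \<theta> Complex.DeMoivre cis_mult)
  finally have "det I = 1" .
  moreover have "k * cnj k = 1"
    by (simp add: k_def cis_cnj cis_mult)
  ultimately have "I \<in> SU h"
    using assms by (simp add: SU_def I h_simps isometry_def mult.assoc[symmetric] mult.commute)
  then show ?thesis
    using that I by (metis cis_neq_zero k_def)
qed

end

section \<open>Products of two reflections on a hyperbolic line\<close>

text \<open>The elliptic slices are determined because a line through \<open>z\<close> meets the unit circle in at most one further point.\<close>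

lemma unit_circle_chord:
  fixes x y z :: complex
  assumes "cmod x = 1" "cmod y = 1" "cmod z = 1" and chord: "x - z = of_real \<rho> * (y - z)"
    and "x \<noteq> z" "x \<noteq> y"
  shows False
proof -
  define d where "d = y - z"
  define g where "g = Re (cnj z * d)"
  have exp: "cmod (z + of_real r * d) ^ 2 = 1 + 2 * r * g + r ^ 2 * cmod d ^ 2" for r
  proof -
    have "cmod z ^ 2 = 1"
      using assms by simp
    then show ?thesis
      unfolding cmod_power2 g_def by (simp add: power2_eq_square algebra_simps)
  qed
  have "x = z + of_real \<rho> * d" "y = z + of_real 1 * d"
    using chord by (simp_all add: d_def algebra_simps)
  then have 1: "2 * \<rho> * g + \<rho> ^ 2 * cmod d ^ 2 = 0" and 2: "2 * g + cmod d ^ 2 = 0"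
    using exp[of \<rho>] exp[of 1] assms by simp_all
  \<comment> \<open>The quadratic polynomial \<open>cmod (z + r * d) ^ 2 - 1\<close> in
    \<open>r\<close> vanishes at 0, 1 and \<rho>; eliminating \<open>g\<close> leaves a product
    whose factors are all nonzero.\<close>
  have "\<rho> * (\<rho> - 1) * cmod d ^ 2 = (2 * \<rho> * g + \<rho> ^ 2 * cmod d ^ 2) - \<rho> * (2 * g + cmod d ^ 2)"
    by (simp add: power2_eq_square algebra_simps)
  then have "\<rho> * (\<rho> - 1) * cmod d ^ 2 = 0"
    by (simp add: 1 2)
  then show False
    using chord assms(5,6) by (auto simp: d_def)
qed

lemma cmod_eq_rotate:
  assumes "cmod a' = cmod a"
  obtains \<theta> where "a' = cis \<theta> * a"
proof (cases "a = 0")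
  case True
  then show ?thesis
    using assms that[of 0] by simp
next
  case False
  then have "cmod (a' / a) = 1"
    using assms by (simp add: norm_divide)
  then obtain \<theta> where "a' / a = cis \<theta>"
    by (metis complex_norm_eq_1_exp cis_conv_exp)
  then show ?thesis
    using that False by (metis nonzero_divide_eq_eq)
qed

text \<open>Intermediate value theorem: the modulus is at most \<open>y\<close> at
  \<open>s = 0\<close>, and it is unbounded as \<open>s\<close> grows if \<open>a\<close> is
  nonzero, as \<open>s\<close> decreases otherwise.\<close>

lemma exp_combination_unbounded:
  fixes a b :: complex
  assumes "a + b \<noteq> 0" "cmod (a + b) \<le> y"
  obtains s :: real where "cmod (exp (of_real s) * a + exp (- of_real s) * b) = y"
proof -
  have *: "\<exists>s::real. cmod (exp (of_real s) * a + exp (- of_real s) * b) = y"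
    if a: "a \<noteq> 0" and y: "cmod (a + b) \<le> y" for a b :: complex
  proof -
    define g where "g = (\<lambda>s::real. cmod (exp (of_real s) * a + exp (- of_real s) * b))"
    \<comment> \<open>Chosen so that \<open>exp S * cmod a\<close> reaches
      \<open>y + cmod b\<close>; the maximum with 0 keeps the decaying term below
      \<open>cmod b\<close>.\<close>
    define S where "S = max 0 (ln ((y + cmod b) / cmod a))"
    have y0: "y \<ge> 0"
      using y norm_ge_zero order_trans by blast
    have "cmod (exp (of_real S) * a) \<ge> y + cmod b"
    proof (cases "y + cmod b > 0")
      case True
      then have "(y + cmod b) / cmod a > 0"
        using a by simp
      then have "(y + cmod b) / cmod a \<le> exp S"
        unfolding S_def by (metis exp_le_cancel_iff exp_ln max.cobounded2)
      then show ?thesis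
        using a by (simp add: norm_mult field_simps)
    next
      case False
      then show ?thesis
        by (meson norm_ge_zero not_le order_trans)
    qed
    moreover have "cmod (exp (- of_real S) * b) \<le> cmod b"
      by (simp add: norm_mult S_def mult_left_le_one_le)
    moreover have "cmod (exp (of_real S) * a) \<le> g S + cmod (exp (- of_real S) * b)"
      unfolding g_def using norm_triangle_ineq4 [of "exp (of_real S) * a + exp (- of_real S) * b"
          "exp (- of_real S) * b"] by simp
    ultimately have "y \<le> g S"
      by linarith
    moreover have "g 0 \<le> y"
      using y by (simp add: g_def)
    moreover have "continuous_on {0..S} g"
      unfolding g_def by (intro continuous_intros)
    ultimately show ?thesis
      using IVT'[of g 0 y S] unfolding g_def S_def by auto
  qed
  show ?thesis
  proof (cases "a = 0")
    case False
    then show ?thesis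
      using *[of a b] assms that by blast
  next
    case True
    then obtain s where "cmod (exp (of_real s) * b + exp (- of_real s) * a) = y"
      using *[of b a] assms by (auto simp: add.commute)
    then show ?thesis
      using that[of "-s"] by (simp add: add.commute)
  qed
qed

definition tance :: "form \<Rightarrow> cvec \<Rightarrow> cvec \<Rightarrow> real" where
  "tance h p q = cmod (h p q) ^ 2 / (cmod (h p p) * cmod (h q q))"

context hermitian
begin

lemma R_isometry:
  assumes "cmod \<alpha> = 1" "h p p \<noteq> 0"
  shows "isometry h (R h \<alpha> p)"
  unfolding isometry_def
proof (intro allI)
  fix x y
  have a: "\<alpha> * cnj \<alpha> = 1"
    using assms(1) by (simp flip: complex_norm_square)
  then have inv: "inverse \<alpha> = cnj \<alpha>"
    by (rule inverse_unique)
  have p: "cnj (h p p) = h p p"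
    by (metis h_cnj)
  define g where "g = h p p"
  have g: "g \<noteq> 0" "cnj g = g"
    using assms p by (auto simp: g_def)
  define d where "d = inverse \<alpha> ^ 2 - \<alpha>"
  \<comment> \<open>The left side is \<open>cmod (\<alpha> + d) ^ 2 - cmod \<alpha> ^ 2\<close>, and
    \<open>\<alpha> + d\<close> is the other unimodular eigenvalue
    \<open>inverse \<alpha> ^ 2\<close>.\<close>
  have d: "d * cnj \<alpha> + cnj d * \<alpha> + d * cnj d = 0"
    using a unfolding d_def inv by (simp add: power2_eq_square) algebra
  have "h (R h \<alpha> p *v x) (R h \<alpha> p *v y) =
      (\<alpha> * cnj \<alpha>) * h x y + (d * cnj \<alpha> + cnj d * \<alpha> + d * cnj d) * (h x p * h p y / g)"
    unfolding R_apply' d_def[symmetric] g_def[symmetric]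
    using g h_cnj[of p y] by (simp add: h_simps g_def[symmetric] field_simps)
  then show "h (R h \<alpha> p *v x) (R h \<alpha> p *v y) = h x y"
    by (simp add: a d)
qed

end

text \<open>A negative point on the line makes its polar vector positive, which permits the
  normalisation \<open>h c c = 1\<close>. The frame condition contains the independence of
  \<open>p\<close> and \<open>q\<close>.\<close>

locale hyperbolic_pair = hermitian_ppm +
  fixes \<alpha> \<beta> :: complex and p q c :: cvec
  assumes \<alpha>: "cmod \<alpha> = 1" "\<alpha> ^ 3 \<noteq> 1" and \<beta>: "cmod \<beta> = 1" "\<beta> ^ 3 \<noteq> 1"
    and pp: "h p p \<noteq> 0" and qq: "h q q \<noteq> 0" and pq: "h p q \<noteq> 0"
    and negative: "Re (h p p) < 0 \<or> Re (h q q) < 0"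
    and frame: "frame p q c"
    and c: "h p c = 0" "h q c = 0" "h c c = 1"
begin

section \<open>The product of two reflections restricted to its line\<close>

definition A where "A = R h \<beta> q ** R h \<alpha> p"
text \<open>The tance with its sign, so that \<open>h p p * h q q * (1 - t)\<close> is the Gram
  determinant of \<open>p\<close> and \<open>q\<close>.\<close>

definition t where "t = h p q * h q p / (h p p * h q q)"
definition d1 where "d1 = inverse \<alpha> ^ 2 - \<alpha>"
definition d2 where "d2 = inverse \<beta> ^ 2 - \<beta>"

lemma nz: "\<alpha> \<noteq> 0" "\<beta> \<noteq> 0" "h q p \<noteq> 0" "d1 \<noteq> 0" "d2 \<noteq> 0"
proof -
  show 1: "\<alpha> \<noteq> 0" "\<beta> \<noteq> 0"
    using \<alpha> \<beta> by auto
  show "h q p \<noteq> 0"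
    using pq h_sym_zero by blast
  show "d1 \<noteq> 0" "d2 \<noteq> 0"
    using 1 \<alpha>(2) \<beta>(2) by (auto simp: d1_def d2_def field_simps power2_eq_square power3_eq_cube)
qed

lemma c_sym: "h c p = 0" "h c q = 0"
  using c h_sym_zero by auto

lemma A_isometry: "isometry h A"
  unfolding A_def using \<alpha> \<beta> pp qq by (intro isometry_mult R_isometry)

lemma hA: "h (A *v x) (A *v y) = h x y"
  using A_isometry by (simp add: isometry_def)

lemma A_c: "A *v c = (\<alpha> * \<beta>) *s c"
  unfolding A_def by (simp add: R_apply' h_simps c_sym mult.commute flip: matrix_vector_mul_assoc)

lemma A_p: "A *v p = (inverse \<alpha> ^ 2 * \<beta>) *s p + (inverse \<alpha> ^ 2 * d2 * h p q / h q q) *s q"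
  unfolding A_def using pp
  by (simp add: R_apply' h_simps d2_def vec_eq_iff algebra_simps flip: matrix_vector_mul_assoc)

lemma A_q: "A *v q = (d1 * \<beta> * h q p / h p p) *s p + (d1 * d2 * t + \<alpha> * inverse \<beta> ^ 2) *s q"
  unfolding A_def using pp qq nz(1,2)
  by (simp add: R_apply' h_simps d1_def d2_def t_def vec_eq_iff field_simps flip: matrix_vector_mul_assoc)

lemma span_iff: "x \<in> vec.span {p, q} \<longleftrightarrow> h x c = 0"
proof
  assume "h x c = 0"
  moreover obtain i j k where "x = i *s p + j *s q + k *s c"
    using frame by (rule frame_span)
  ultimately show "x \<in> vec.span {p, q}"
    by (auto simp: mem_span2 h_simps c)
qed (auto simp: mem_span2 h_simps c)

lemma A_line: "h x c = 0 \<Longrightarrow> h (A *v x) c = 0"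
  using hA[of x c] nz by (simp add: A_c h_simps)

definition orthonormal where
  "orthonormal n m \<longleftrightarrow> h n n = -1 \<and> h m m = 1 \<and> h n m = 0 \<and> h n c = 0 \<and> h m c = 0"

text \<open>The basis of the line suited to loxodromic and parabolic products, as
  \<open>orthonormal\<close> is to elliptic ones.\<close>

definition null_pair where
  "null_pair v w \<longleftrightarrow> h v v = 0 \<and> h w w = 0 \<and> h v w = 1 \<and> h v c = 0 \<and> h w c = 0"

lemma orthonormal_sym:
  assumes "orthonormal n m"
  shows "h m n = 0" "h c n = 0" "h c m = 0"
  using assms h_sym_zero by (auto simp: orthonormal_def)

lemma null_pair_sym:
  assumes "null_pair v w"
  shows "h w v = 1" "h c v = 0" "h c w = 0"
  using assms h_sym_zero h_cnj[of w v] by (auto simp: null_pair_def)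

lemma orthonormal_frame: "orthonormal n m \<Longrightarrow> frame n m c"
  using c by (intro orthogonal_frame) (auto simp: orthonormal_def)

lemma null_pair_frame:
  assumes "null_pair v w"
  shows "frame v w c"
  unfolding frame_def
proof (intro allI impI)
  fix i j k
  assume *: "i *s v + j *s w + k *s c = 0"
  have "h (i *s v + j *s w + k *s c) x = 0" for x
    by (simp add: * h_zero_left)
  from this[of v] this[of w] this[of c] show "i = 0 \<and> j = 0 \<and> k = 0"
    using assms null_pair_sym[OF assms] c by (auto simp: h_simps null_pair_def)
qed

lemma orthonormal_coords:
  assumes "orthonormal n m" "h x c = 0"
  obtains a b where "x = a *s n + b *s m" "a = - h x n" "b = h x m"
proof -
  obtain a b k where x: "x = a *s n + b *s m + k *s c"
    using orthonormal_frame[OF assms(1)] by (rule frame_span)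
  have "k = 0"
    using assms c unfolding x by (simp add: h_simps orthonormal_def)
  then have x': "x = a *s n + b *s m"
    by (simp add: x)
  moreover have "a = - h x n" "b = h x m"
    using assms(1) orthonormal_sym[OF assms(1)] by (simp_all add: x' h_simps orthonormal_def)
  ultimately show ?thesis
    by (rule that)
qed

lemma null_pair_coords:
  assumes "null_pair v w" "h x c = 0"
  obtains a b where "x = a *s v + b *s w" "a = h x w" "b = h x v"
proof -
  obtain a b k where x: "x = a *s v + b *s w + k *s c"
    using null_pair_frame[OF assms(1)] by (rule frame_span)
  have "k = 0"
    using assms c unfolding x by (simp add: h_simps null_pair_def)
  then have x': "x = a *s v + b *s w"
    by (simp add: x)
  moreover have "a = h x w" "b = h x v"
    using assms(1) null_pair_sym[OF assms(1)] by (simp_all add: x' h_simps null_pair_def)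
  ultimately show ?thesis
    by (rule that)
qed

lemma orthonormal_scale:
  assumes "h n m = 0" "h n c = 0" "h m c = 0" "Re (h n n) < 0" "Re (h m m) > 0"
  shows "orthonormal (of_real (1 / sqrt (- Re (h n n))) *s n) (of_real (1 / sqrt (Re (h m m))) *s m)"
proof -
  define r where "r = sqrt (- Re (h n n))"
  have "h n n = - of_real (r ^ 2)" "r > 0"
    using assms by (simp_all add: r_def flip: h_self)
  moreover define r' where "r' = sqrt (Re (h m m))"
  have "h m m = of_real (r' ^ 2)" "r' > 0"
    using assms by (simp_all add: r'_def flip: h_self)
  ultimately show ?thesis
    using assms by (simp add: orthonormal_def h_simps power2_eq_square flip: r_def r'_def)
qed

text \<open>Gram-Schmidt starting at a negative point \<open>x\<close> of the pair: the remainder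
  \<open>m\<close> of the other point \<open>y\<close> is positive, and \<open>h m m\<close> is
  \<open>h y y\<close> times one minus the signed tance.\<close>

lemma t_ne_1: "t \<noteq> 1" and orthonormal_ex: "\<exists>n m. orthonormal n m"
proof -
  have *: "h x y * h y x / (h x x * h y y) \<noteq> 1 \<and> (\<exists>n m. orthonormal n m)"
    if x: "Re (h x x) < 0" and y: "h y y \<noteq> 0" "h x c = 0" "h y c = 0"
      and indep: "\<And>k. y \<noteq> k *s x" for x y
  proof -
    define m where "m = y - (h y x / h x x) *s x"
    have xx: "h x x \<noteq> 0"
      using x by auto
    have mx: "h m x = 0"
      using xx by (simp add: m_def h_simps)
    moreover have "m \<noteq> 0"
      using indep[of "h y x / h x x"] by (auto simp: m_def)
    ultimately have m: "Re (h m m) > 0"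
      using x negative_perp_positive by blast
    have mc: "h m c = 0"
      using y by (simp add: m_def h_simps)
    have "h m m = h y y * (1 - h x y * h y x / (h x x * h y y))"
      using xx y mx[THEN h_sym_zero]
      by (simp add: m_def h_simps field_simps)
    then have "h x y * h y x / (h x x * h y y) \<noteq> 1"
      using m by auto
    moreover have "\<exists>n m. orthonormal n m"
      using orthonormal_scale[OF h_sym_zero[OF mx] y(2) mc x m] by blast
    ultimately show ?thesis
      by blast
  qed
  have "q \<noteq> k *s p" for k
    using frame[unfolded frame_def, rule_format, of k "-1" 0] by auto
  moreover have "p \<noteq> k *s q" for k
    using frame[unfolded frame_def, rule_format, of "-1" k 0] by auto
  ultimately show "t \<noteq> 1" "\<exists>n m. orthonormal n m"
    using negative *[of p q] *[of q p] c pp qq unfolding t_def by (auto simp: mult.commute)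
qed

text \<open>\<open>T\<close> is the trace of \<open>A\<close> on the line spanned by \<open>p\<close> and \<open>q\<close>.\<close>

definition T where "T = inverse \<alpha> ^ 2 * \<beta> + \<alpha> * inverse \<beta> ^ 2 + d1 * d2 * t"

text \<open>The determinant on the line is \<open>inverse (\<alpha> * \<beta>)\<close> because
  reflections have determinant 1 and \<open>A\<close> multiplies \<open>c\<close> by
  \<open>\<alpha> * \<beta>\<close>.\<close>

lemma characteristic_equation:
  assumes "A *v v = l *s v" "h v c = 0" "v \<noteq> 0"
  shows "l ^ 2 - T * l + inverse (\<alpha> * \<beta>) = 0"
proof -
  obtain a b where v: "v = a *s p + b *s q"
    using assms(2) by (auto simp: mem_span2 simp flip: span_iff)
  define a11 a21 a12 a22 where "a11 = inverse \<alpha> ^ 2 * \<beta>" "a21 = inverse \<alpha> ^ 2 * d2 * h p q / h q q"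
    "a12 = d1 * \<beta> * h q p / h p p" "a22 = d1 * d2 * t + \<alpha> * inverse \<beta> ^ 2"
  note defs = this
  have "A *v v - l *s v = (a11 * a + a12 * b - l * a) *s p + (a21 * a + a22 * b - l * b) *s q + 0 *s c"
    by (simp add: v matrix_vector_right_distrib vector_scalar_commute A_p A_q flip: defs)
      (simp add: vec_eq_iff algebra_simps)
  then have "a11 * a + a12 * b - l * a = 0 \<and> a21 * a + a22 * b - l * b = 0"
    using frame assms(1) unfolding frame_def by (metis diff_self)
  \<comment> \<open>Multiplication by the adjugate of the matrix of \<open>A - l\<close>: its
    determinant kills both coordinates of \<open>v\<close>.\<close>
  then have "((l - a11) * (l - a22) - a12 * a21) * a = 0" "((l - a11) * (l - a22) - a12 * a21) * b = 0"
    by algebra+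
  moreover have "a \<noteq> 0 \<or> b \<noteq> 0"
    using assms v by auto
  ultimately have "(l - a11) * (l - a22) - a12 * a21 = 0"
    by auto
  moreover have "a11 * a22 - a12 * a21 = inverse (\<alpha> * \<beta>)"
    using nz pp qq by (simp add: defs t_def field_simps power2_eq_square)
  moreover have "a11 + a22 = T"
    by (simp add: defs T_def)
  ultimately show ?thesis
    by algebra
qed

lemma eigenvector_ex:
  obtains v l where "A *v v = l *s v" "h v c = 0" "v \<noteq> 0"
proof -
  define l where "l = (T + csqrt (T ^ 2 - 4 * inverse (\<alpha> * \<beta>))) / 2"
  have "(csqrt (T ^ 2 - 4 * inverse (\<alpha> * \<beta>))) ^ 2 = T ^ 2 - 4 * inverse (\<alpha> * \<beta>)"
    by simp
  moreover have "csqrt (T ^ 2 - 4 * inverse (\<alpha> * \<beta>)) = 2 * l - T"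
    by (simp add: l_def field_simps)
  ultimately have l: "l ^ 2 - T * l + inverse (\<alpha> * \<beta>) = 0"
    by algebra
  define a11 a21 a12 a22 where "a11 = inverse \<alpha> ^ 2 * \<beta>" "a21 = inverse \<alpha> ^ 2 * d2 * h p q / h q q"
    "a12 = d1 * \<beta> * h q p / h p p" "a22 = d1 * d2 * t + \<alpha> * inverse \<beta> ^ 2"
  note defs = this
  have "a11 * a22 - a12 * a21 = inverse (\<alpha> * \<beta>)"
    using nz pp qq by (simp add: defs t_def field_simps power2_eq_square)
  moreover have "a11 + a22 = T"
    by (simp add: defs T_def)
  moreover define b where "b = l - a11"
  ultimately have 1: "a11 * a12 + a12 * b = l * a12" and 2: "a21 * a12 + a22 * b = l * b"
    using l by algebra+
  \<comment> \<open>A kernel vector of the first row of the matrix of \<open>A - l\<close>; the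
    second row then vanishes by the characteristic equation.\<close>
  define v where "v = a12 *s p + b *s q"
  have "A *v v = (a11 * a12 + a12 * b) *s p + (a21 * a12 + a22 * b) *s q"
    by (simp add: v_def matrix_vector_right_distrib vector_scalar_commute A_p A_q flip: defs)
      (simp add: vec_eq_iff algebra_simps)
  also have "\<dots> = l *s v"
    unfolding 1 2 by (simp add: v_def vec_eq_iff algebra_simps)
  finally have "A *v v = l *s v" .
  moreover have "a12 \<noteq> 0"
    using nz pp by (simp add: defs)
  then have "v \<noteq> 0"
    using frame[unfolded frame_def, rule_format, of a12 b 0] by (auto simp: v_def)
  moreover have "h v c = 0"
    by (simp add: v_def h_simps c)
  ultimately show ?thesis
    using that by blast
qed

text \<open>The characteristic polynomial of the line takes the value
  \<open>\<alpha> * \<beta> * d1 * d2 * (1 - t)\<close> at the eigenvalue of \<open>c\<close>. This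
  separates the polar point from the fixed points on the line.\<close>

lemma eigenvalue_ne:
  assumes "A *v v = l *s v" "h v c = 0" "v \<noteq> 0"
  shows "l \<noteq> \<alpha> * \<beta>"
proof
  assume "l = \<alpha> * \<beta>"
  then have "(\<alpha> * \<beta>) ^ 2 - T * (\<alpha> * \<beta>) + inverse (\<alpha> * \<beta>) = 0"
    using characteristic_equation[OF assms] by simp
  moreover have "(\<alpha> * \<beta>) ^ 2 - T * (\<alpha> * \<beta>) + inverse (\<alpha> * \<beta>) = \<alpha> * \<beta> * d1 * d2 * (1 - t)"
    unfolding T_def d1_def d2_def using nz(1,2) by (simp add: field_simps) algebra
  ultimately show False
    using nz t_ne_1 by simp
qed

text \<open>If \<open>cmod l = 1\<close>, then \<open>d1 * d2 * t\<close> is a sum of four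
  unimodular terms: the two eigenvalues \<open>l\<close> and
  \<open>inverse (\<alpha> * \<beta>) / l\<close>, and the two other summands of \<open>T\<close>.
  This is the source of the 4.\<close>

lemma eigenvalue_unit_bound:
  assumes "A *v v = l *s v" "h v c = 0" "v \<noteq> 0" "cmod l = 1"
  shows "cmod t \<le> 4 / (cmod d1 * cmod d2)"
proof -
  have "l \<noteq> 0"
    using assms by auto
  have "l * T = l * (l + inverse (\<alpha> * \<beta>) / l)"
    using characteristic_equation[OF assms(1-3)] \<open>l \<noteq> 0\<close> by (simp add: field_simps power2_eq_square)
  then have "T = l + inverse (\<alpha> * \<beta>) / l"
    using \<open>l \<noteq> 0\<close> by simp
  then have "d1 * d2 * t = l + inverse (\<alpha> * \<beta>) / l - inverse \<alpha> ^ 2 * \<beta> - \<alpha> * inverse \<beta> ^ 2"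
    by (simp add: T_def algebra_simps)
  also have "cmod \<dots> \<le> cmod l + cmod (inverse (\<alpha> * \<beta>) / l) + cmod (inverse \<alpha> ^ 2 * \<beta>) + cmod (\<alpha> * inverse \<beta> ^ 2)"
    by (intro order_trans[OF norm_triangle_ineq4] add_right_mono norm_triangle_ineq)
  also have "\<dots> = 4"
    using assms \<alpha> \<beta> by (simp add: norm_mult norm_divide norm_inverse norm_power)
  finally show ?thesis
    using nz by (simp add: norm_mult field_simps)
qed

text \<open>The component of \<open>A *v p\<close> along \<open>q\<close> is a nonzero multiple of
  \<open>h p q\<close>. It rules out equal eigenvalues in a diagonal form.\<close>

lemma not_scalar: "A *v p \<noteq> l *s p"
proof
  assume "A *v p = l *s p"
  then have "(inverse \<alpha> ^ 2 * \<beta> - l) *s p + (inverse \<alpha> ^ 2 * d2 * h p q / h q q) *s q + 0 *s c = 0"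
    by (simp add: A_p vec_eq_iff algebra_simps)
  then have "inverse \<alpha> ^ 2 * d2 * h p q / h q q = 0"
    using frame unfolding frame_def by blast
  then show False
    using nz pq qq by simp
qed

section \<open>Normal forms of the product on its line\<close>

definition elliptic_basis where
  "elliptic_basis n m l \<mu> \<longleftrightarrow> orthonormal n m \<and> A *v n = l *s n \<and> A *v m = \<mu> *s m \<and>
     cmod l = 1 \<and> cmod \<mu> = 1 \<and> l \<noteq> \<mu> \<and> l \<noteq> \<alpha> * \<beta> \<and> \<mu> \<noteq> \<alpha> * \<beta>"

definition loxodromic_basis where
  "loxodromic_basis v w l \<mu> \<longleftrightarrow> null_pair v w \<and> A *v v = l *s v \<and> A *v w = \<mu> *s w \<and>
     l * cnj \<mu> = 1 \<and> cmod l \<noteq> 1"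

text \<open>The off-diagonal entry is \<l> times an imaginary number because the image of the
  isotropic \<open>w\<close> has to be isotropic.\<close>

definition parabolic_basis where
  "parabolic_basis v w l k \<longleftrightarrow> null_pair v w \<and> A *v v = l *s v \<and>
     A *v w = l *s w + (l * \<i> * of_real k) *s v \<and> cmod l = 1 \<and> k \<noteq> (0::real) \<and> l \<noteq> \<alpha> * \<beta>"

lemma eigenvalue_unit:
  assumes "A *v v = l *s v" "h v v \<noteq> 0"
  shows "cmod l = 1"
proof -
  have "l * cnj l = 1"
    using hA[of v v] assms by (simp add: h_simps mult.commute)
  then show ?thesis
    by (metis complex_mod_sqrt_Re_mult_cnj one_complex.sel(1) real_sqrt_one)
qed

text \<open>One eigenvector suffices: an isometry preserves its orthogonal complement, which is
  one-dimensional in the line.\<close>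

lemma elliptic_basisI:
  assumes "orthonormal n m" "A *v n = l *s n \<or> A *v m = l *s m"
  shows "\<exists>l \<mu>. elliptic_basis n m l \<mu>"
proof -
  note o = assms(1)[unfolded orthonormal_def] orthonormal_sym[OF assms(1)]
  have nm: "n \<noteq> 0" "m \<noteq> 0"
    using o h_zero_left by (metis zero_neq_one neg_equal_0_iff_equal)+
  have l: "cmod l = 1"
    using assms(2) o by (auto intro: eigenvalue_unit)
  have "\<exists>l \<mu>. A *v n = l *s n \<and> A *v m = \<mu> *s m"
    using assms(2)
  proof
    assume n: "A *v n = l *s n"
    have "h (A *v m) (l *s n) = 0"
      using hA[of m n] o n by simp
    then have 0: "h (A *v m) n = 0"
      using l by (auto simp: h_simps)
    have "h (A *v m) c = 0"
      using o A_line by blast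
    then obtain a b where "A *v m = a *s n + b *s m" "a = - h (A *v m) n"
      by (rule orthonormal_coords[OF assms(1)])
    then have "A *v m = b *s m"
      by (simp only: 0) simp
    with n show ?thesis by blast
  next
    assume m: "A *v m = l *s m"
    have "h (A *v n) (l *s m) = 0"
      using hA[of n m] o m by simp
    then have 0: "h (A *v n) m = 0"
      using l by (auto simp: h_simps)
    have "h (A *v n) c = 0"
      using o A_line by blast
    then obtain b a where "A *v n = b *s n + a *s m" "a = h (A *v n) m"
      by (rule orthonormal_coords[OF assms(1)])
    then have "A *v n = b *s n"
      by (simp only: 0) simp
    with m show ?thesis by blast
  qed
  then obtain l \<mu> where e: "A *v n = l *s n" "A *v m = \<mu> *s m"
    by blast
  have "l \<noteq> \<mu>"
  proof
    assume "l = \<mu>"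
    obtain a b where "p = a *s n + b *s m"
      using orthonormal_coords[OF assms(1) c(1)] by metis
    then have "A *v p = l *s p"
      using e \<open>l = \<mu>\<close> by (simp add: matrix_vector_right_distrib vector_scalar_commute)
        (simp add: vec_eq_iff algebra_simps)
    then show False
      using not_scalar by blast
  qed
  moreover have "cmod l = 1" "cmod \<mu> = 1"
    using e o eigenvalue_unit[OF e(1)] eigenvalue_unit[OF e(2)] by auto
  moreover have "l \<noteq> \<alpha> * \<beta>" "\<mu> \<noteq> \<alpha> * \<beta>"
    using eigenvalue_ne e o nm by blast+
  ultimately show ?thesis
    using assms(1) e unfolding elliptic_basis_def by blast
qed

lemma nonisotropic_elliptic:
  assumes v: "A *v v = l *s v" "h v c = 0" "h v v \<noteq> 0"
  shows "\<exists>n m l \<mu>. elliptic_basis n m l \<mu>"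
proof -
  obtain n m where o: "orthonormal n m"
    using orthonormal_ex by blast
  obtain a b where ab: "v = a *s n + b *s m"
    using orthonormal_coords[OF o v(2)] by metis
  note o' = o[unfolded orthonormal_def] orthonormal_sym[OF o]
  \<comment> \<open>The orthogonal complement of \<open>v\<close> in the line, scaled to the
    opposite norm.\<close>
  define v' where "v' = cnj b *s n + cnj a *s m"
  have v': "h v' v' = - h v v" "h v' v = 0" "h v' c = 0"
    using o' by (simp_all add: v'_def ab h_simps algebra_simps)
  have "h v v = of_real (Re (h v v))"
    by (rule h_self)
  then consider "Re (h v v) < 0" | "Re (h v v) > 0"
    using v(3) by (metis linorder_neqE_linordered_idom of_real_0)
  then show ?thesis
  proof cases
    case 1
    then have "orthonormal (of_real (1 / sqrt (- Re (h v v))) *s v) (of_real (1 / sqrt (Re (h v' v'))) *s v')"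
      using v v' h_sym_zero by (intro orthonormal_scale) auto
    then show ?thesis
      using elliptic_basisI[of _ _ l] v by (metis vector_scalar_commute vector_smult_assoc mult.commute)
  next
    case 2
    then have "orthonormal (of_real (1 / sqrt (- Re (h v' v'))) *s v') (of_real (1 / sqrt (Re (h v v))) *s v)"
      using v v' by (intro orthonormal_scale) auto
    then show ?thesis
      using elliptic_basisI[of _ _ l] v by (metis vector_scalar_commute vector_smult_assoc mult.commute)
  qed
qed

lemma null_pair_ex:
  assumes "h v v = 0" "h v c = 0" "v \<noteq> 0"
  shows "\<exists>w. null_pair v w"
proof -
  obtain n m where o: "orthonormal n m"
    using orthonormal_ex by blast
  obtain a b where ab: "v = a *s n + b *s m"
    using orthonormal_coords[OF o assms(2)] by metis
  note o' = o[unfolded orthonormal_def] orthonormal_sym[OF o]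
  have eq: "b * cnj b = a * cnj a"
    using assms(1) o' by (simp add: ab h_simps mult.commute)
  then have "a \<noteq> 0"
    using assms(3) ab by auto
  \<comment> \<open>\<open>w\<close> will be a multiple of \<open>a *s n - b *s m\<close>, isotropic
    together with \<open>v\<close>; this real factor makes \<open>h v w = 1\<close>.\<close>
  define k where "k = - 1 / (2 * (a * cnj a))"
  have k: "cnj k = k" "k * (2 * (a * cnj a)) = -1"
    using \<open>a \<noteq> 0\<close> by (simp_all add: k_def mult.commute)
  define w where "w = (k * a) *s n + (- k * b) *s m"
  have "h v w = - (k * (a * cnj a + b * cnj b))" "h w w = k * k * (b * cnj b - a * cnj a)"
    using o' k by (simp_all add: ab w_def h_simps algebra_simps)
  then have "null_pair v w"
    using k(2) assms o' by (simp add: null_pair_def eq w_def h_simps)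
  then show ?thesis ..
qed

text \<open>A nonisotropic eigenvector leads to the elliptic form. An isotropic one is completed to
  a null pair, where \<open>A\<close> is triangular: with distinct diagonal entries it can be
  diagonalised, with equal ones it is parabolic.\<close>

lemma trichotomy:
  obtains (elliptic) n m l \<mu> where "elliptic_basis n m l \<mu>"
  | (loxodromic) v w l \<mu> where "loxodromic_basis v w l \<mu>"
  | (parabolic) v w l k where "parabolic_basis v w l k"
proof -
  obtain v l where v: "A *v v = l *s v" "h v c = 0" "v \<noteq> 0"
    using eigenvector_ex by blast
  show ?thesis
  proof (cases "h v v = 0")
    case False
    then show ?thesis
      using nonisotropic_elliptic[OF v(1,2)] elliptic by blast
  next
    case True
    then obtain w where vw: "null_pair v w"
      using null_pair_ex v by blast
    note o = vw[unfolded null_pair_def] null_pair_sym[OF vw]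
    obtain x \<mu> where w: "A *v w = x *s v + \<mu> *s w"
      using null_pair_coords[OF vw A_line[of w]] o by metis
    have l\<mu>: "l * cnj \<mu> = 1"
      using hA[of v w] o by (simp add: v(1) w h_simps mult.commute)
    have x: "x * cnj \<mu> + \<mu> * cnj x = 0"
      using hA[of w w] o by (simp add: w h_simps ac_simps)
    show ?thesis
    proof (cases "\<mu> = l")
      case False
      \<comment> \<open>The shift along \<open>v\<close> that turns \<open>w\<close> into an
        eigenvector for \<mu>.\<close>
      define y where "y = x / (\<mu> - l)"
      define w' where "w' = w + y *s v"
      have y: "x + y * l = \<mu> * y"
        using False by (simp add: y_def field_simps)
      have "A *v w' = (x + y * l) *s v + \<mu> *s w"
        by (simp add: w'_def matrix_vector_right_distrib vector_scalar_commute v(1) w)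
      also have "\<dots> = \<mu> *s w'"
        unfolding y by (simp add: w'_def vec_eq_iff algebra_simps)
      finally have Aw': "A *v w' = \<mu> *s w'" .
      have w'c: "h w' c = 0"
        using o by (simp add: w'_def h_simps)
      show ?thesis
      proof (cases "h w' w' = 0")
        case True
        then have "null_pair v w'"
          using o w'c by (simp add: null_pair_def) (simp add: w'_def h_simps)
        moreover have "cmod l \<noteq> 1"
        proof
          assume "cmod l = 1"
          then have "l * cnj l = 1"
            by (simp add: complex_norm_square[symmetric])
          then have "l * (cnj \<mu> - cnj l) = 0"
            using l\<mu> by (simp add: algebra_simps)
          then show False
            using False \<open>cmod l = 1\<close> by auto
        qed
        ultimately show ?thesis
          using loxodromic[of v w' l \<mu>] Aw' v l\<mu> unfolding loxodromic_basis_def by blast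
      next
        case False
        then show ?thesis
          using nonisotropic_elliptic[OF Aw' w'c] elliptic by blast
      qed
    next
      case True
      \<comment> \<open>Isotropy of \<open>A *v w\<close> says that this number is purely imaginary,
        which gives the real parameter of the parabolic form.\<close>
      define z where "z = x * cnj l"
      have "z + cnj z = 0"
        using x True by (simp add: z_def mult.commute)
      then have z: "z = \<i> * of_real (Im z)"
        by (simp add: complex_eq_iff)
      have xz: "x = l * z"
        using l\<mu> True by (simp add: z_def mult.left_commute)
      have "Im z \<noteq> 0"
      proof
        assume "Im z = 0"
        then have "x = 0"
          using xz z by simp
        obtain a b where "p = a *s v + b *s w"
          using null_pair_coords[OF vw c(1)] by metis
        then have "A *v p = l *s p"
          using v w True \<open>x = 0\<close> by (simp add: matrix_vector_right_distrib vector_scalar_commute)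
            (simp add: vec_eq_iff algebra_simps)
        then show False
          using not_scalar by blast
      qed
      moreover have "A *v w = l *s w + (l * \<i> * of_real (Im z)) *s v"
        using w True xz z by (metis add.commute mult.assoc)
      moreover have "cmod l = 1"
        using l\<mu> True by (metis complex_mod_sqrt_Re_mult_cnj one_complex.sel(1) real_sqrt_one)
      moreover have "l \<noteq> \<alpha> * \<beta>"
        using v by (rule eigenvalue_ne)
      ultimately show ?thesis
        using parabolic[of v w l "Im z"] vw v unfolding parabolic_basis_def by blast
    qed
  qed
qed

end

text \<open>Gram-Schmidt on the frame, starting at the negative point: the last vector is orthogonal
  to a negative one, hence positive, and can be normalised to serve as \<open>c\<close>.\<close>

lemma (in hermitian_ppm) hyperbolic_pairI:
  assumes "cmod \<alpha> = 1" "\<alpha> ^ 3 \<noteq> 1" "cmod \<beta> = 1" "\<beta> ^ 3 \<noteq> 1"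
    and "h p p \<noteq> 0" "h q q \<noteq> 0" "h p q \<noteq> 0" and neg: "Re (h p p) < 0 \<or> Re (h q q) < 0"
    and fr: "frame p q r"
  shows "\<exists>c. hyperbolic_pair h \<alpha> \<beta> p q c"
proof -
  have *: "\<exists>c. h x c = 0 \<and> h y c = 0 \<and> h c c = 1"
    if x: "Re (h x x) < 0" and fr: "frame x y r" for x y
  proof -
    have xx: "h x x \<noteq> 0"
      using x by auto
    define m where "m = y - (h y x / h x x) *s x"
    have mx: "h m x = 0"
      using xx by (simp add: m_def h_simps)
    moreover have "m \<noteq> 0"
      using fr[unfolded frame_def, rule_format, of "- (h y x / h x x)" 1 0] by (auto simp: m_def)
    ultimately have m: "Re (h m m) > 0"
      using x negative_perp_positive by blast
    then have mm: "h m m \<noteq> 0"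
      by auto
    define c where "c = r - (h r x / h x x) *s x - (h r m / h m m) *s m"
    have cx: "h c x = 0" and cm: "h c m = 0"
      using xx mm mx mx[THEN h_sym_zero] by (simp_all add: c_def h_simps)
    have "c \<noteq> 0"
    proof
      assume "c = 0"
      define k where "k = h r m / h m m"
      have mi: "m $ i = y $ i - (h y x / h x x) * x $ i" for i
        by (simp add: m_def)
      \<comment> \<open>In terms of the given frame, \<open>c\<close> has coefficient 1 at
        \<open>r\<close>, so it cannot vanish.\<close>
      have "(k * (h y x / h x x) - h r x / h x x) *s x + (- k) *s y + 1 *s r = c"
        by (simp add: c_def mi vec_eq_iff algebra_simps flip: k_def)
      then show False
        using \<open>c = 0\<close> fr unfolding frame_def by (metis zero_neq_one)
    qed
    then have cc: "Re (h c c) > 0"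
      using negative_perp_positive x cx by blast
    define s where "s = sqrt (Re (h c c))"
    have s: "h c c = of_real (s ^ 2)" "s > 0"
      using cc by (simp_all add: s_def flip: h_self)
    have "h c y = 0"
      using cm cx by (simp add: m_def h_simps)
    then have "h y c = 0" "h x c = 0"
      using h_sym_zero cx by blast+
    then show ?thesis
      using s by (intro exI[of _ "of_real (1 / s) *s c"]) (simp add: h_simps power2_eq_square)
  qed
  have "frame q p r"
    using fr unfolding frame_def by (metis add.commute)
  then obtain c where c: "h p c = 0" "h q c = 0" "h c c = 1"
    using neg *[of p q] *[of q p] fr by blast
  have "frame p q c"
    unfolding frame_def
  proof (intro allI impI)
    fix i j k
    assume eq: "i *s p + j *s q + k *s c = 0"
    then have "h (i *s p + j *s q + k *s c) c = 0"
      by (simp add: h_zero_left)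
    then have "k = 0"
      by (simp add: h_simps c)
    then show "i = 0 \<and> j = 0 \<and> k = 0"
      using eq fr[unfolded frame_def, rule_format, of i j 0] by simp
  qed
  then show ?thesis
    using assms c by (intro exI[of _ c] hyperbolic_pair.intro hyperbolic_pair_axioms.intro
        hermitian_ppm_axioms) auto
qed

context hyperbolic_pair
begin

lemma not_same_point: "\<not> same_point p q"
proof
  assume "same_point p q"
  then obtain k where "q = k *s p"
    unfolding same_point_def by blast
  then show False
    using frame[unfolded frame_def, rule_format, of k "-1" 0] by auto
qed

lemma frame_perp_ne_0: "frame p q r \<Longrightarrow> h r c \<noteq> 0"
proof
  assume fr: "frame p q r" and "h r c = 0"
  then obtain a b where "r = a *s p + b *s q"
    by (auto simp: mem_span2 simp flip: span_iff)
  then show False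
    using fr[unfolded frame_def, rule_format, of a b "-1"] by auto
qed

lemma noneuclidean_span: "noneuclidean h (vec.span {p, q})"
  unfolding noneuclidean_def
proof (intro ballI impI)
  fix x
  assume x: "x \<in> vec.span {p, q}" and *: "\<forall>y\<in>vec.span {p, q}. h x y = 0"
  show "x = 0"
  proof (rule nondegenerate)
    fix y
    obtain i j k where y: "y = i *s p + j *s q + k *s c"
      using frame by (rule frame_span)
    have "h x p = 0" "h x q = 0" "h x c = 0"
      using * x by (auto simp: span_iff c)
    then show "h x y = 0"
      by (simp add: y h_simps)
  qed
qed

lemma polar_c: "polar_point h (vec.span {p, q}) c"
  using c by (auto simp: polar_point_def span_iff h_zero_left)

text \<open>Covers the loxodromic (\<open>x = 0\<close>) and the parabolic (\<open>l = \<mu>\<close>) normal form at once.\<close>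

lemma eigenvector_sig:
  assumes fr: "frame v w c" and e: "A *v v = l *s v" "A *v w = \<mu> *s w + x *s v"
    and l: "l \<noteq> \<mu> \<and> x = 0 \<or> l = \<mu> \<and> x \<noteq> 0" "l \<noteq> \<alpha> * \<beta>" "\<mu> \<noteq> \<alpha> * \<beta>"
    and n: "h v v = 0" "h w w = 0" "h v c = 0" "h w c = 0"
    and u: "fixed_point A u"
  shows "sig h u \<noteq> -1" "sig h u = 0 \<longrightarrow> same_point v u \<or> same_point w u \<and> x = 0"
proof -
  obtain k where u: "u \<noteq> 0" "A *v u = k *s u"
    using u unfolding fixed_point_def by blast
  obtain a b d where abd: "u = a *s v + b *s w + d *s c"
    using fr by (rule frame_span)
  have "(a * (l - k) + b * x) *s v + (b * (\<mu> - k)) *s w + (d * (\<alpha> * \<beta> - k)) *s c = A *v u - k *s u"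
    by (simp add: abd matrix_vector_right_distrib vector_scalar_commute e A_c)
      (simp add: vec_eq_iff algebra_simps)
  also have "\<dots> = 0"
    by (simp add: u)
  finally have *: "a * (l - k) + b * x = 0" "b * (\<mu> - k) = 0" "d * (\<alpha> * \<beta> - k) = 0"
    using fr unfolding frame_def by blast+
  then have one: "a \<noteq> 0 \<and> b = 0 \<and> d = 0 \<or> a = 0 \<and> b \<noteq> 0 \<and> d = 0 \<and> x = 0 \<or> a = 0 \<and> b = 0 \<and> d \<noteq> 0"
  proof -
    have "a \<noteq> 0 \<or> b \<noteq> 0 \<or> d \<noteq> 0"
      using u(1) abd by auto
    with * l show ?thesis
      by (cases "k = l"; cases "k = \<mu>"; cases "k = \<alpha> * \<beta>") auto
  qed
  moreover have "h c v = 0" "h c w = 0"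
    using n h_sym_zero by blast+
  \<comment> \<open>By \<open>one\<close> only a single coordinate is nonzero, so there are no cross
    terms; \<open>v\<close> and \<open>w\<close> are isotropic, and only the coordinate along
    \<open>c\<close> contributes.\<close>
  ultimately have huu: "h u u = d * cnj d"
    using n c by (auto simp: abd h_simps)
  also have "\<dots> = of_real (cmod d ^ 2)"
    by (rule complex_norm_square[symmetric])
  finally have "Re (h u u) = cmod d ^ 2"
    by simp
  then have s: "sig h u = sgn (cmod d ^ 2)"
    by (simp add: sig_def)
  have "sgn (cmod d ^ 2) \<ge> 0"
    by (simp add: sgn_if)
  then show "sig h u \<noteq> -1"
    using s by linarith
  show "sig h u = 0 \<longrightarrow> same_point v u \<or> same_point w u \<and> x = 0"
  proof
    assume "sig h u = 0"
    then have "d = 0"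
      using s by (simp add: sgn_if split: if_splits)
    then show "same_point v u \<or> same_point w u \<and> x = 0"
      using one abd by (auto simp: same_point_def)
  qed
qed

lemma null_pair_not_same: "null_pair v w \<Longrightarrow> \<not> same_point v w"
  by (auto simp: null_pair_def same_point_def h_simps)

lemma null_pair_fixed:
  assumes "null_pair v w"
  shows "v \<noteq> 0" "w \<noteq> 0" "sig h v = 0" "sig h w = 0"
  using assms by (auto simp: null_pair_def h_simps sig_def)

lemma loxodromic_basis_loxodromic:
  assumes "loxodromic_basis v w l \<mu>"
  shows "loxodromic h A"
proof -
  note lb = assms[unfolded loxodromic_basis_def]
  have vw: "null_pair v w"
    using lb by blast
  note nv = null_pair_fixed[OF vw]
  have "cmod l * cmod \<mu> = 1"
    using lb by (metis complex_mod_cnj norm_mult norm_one)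
  \<comment> \<open>The eigenvalues \<open>l\<close>, \<open>\<alpha> * \<beta>\<close> and \<mu>
    have moduli \<open>r\<close>, 1 and \<open>1 / r\<close> with \<open>r\<close> different from 1,
    hence they are distinct.\<close>
  then have "cmod \<mu> \<noteq> 1" "cmod \<mu> \<noteq> cmod l"
    using lb abs_square_eq_1[of "cmod l"] by (auto simp: power2_eq_square)
  moreover have "cmod (\<alpha> * \<beta>) = 1"
    using \<alpha> \<beta> by (simp add: norm_mult)
  ultimately have l: "l \<noteq> \<mu> \<and> 0 = 0 \<or> l = \<mu> \<and> (0::complex) \<noteq> 0" "l \<noteq> \<alpha> * \<beta>" "\<mu> \<noteq> \<alpha> * \<beta>"
    using lb by auto
  have "A *v w = \<mu> *s w + 0 *s v"
    using lb by simp
  note e = eigenvector_sig[OF null_pair_frame[OF vw] _ this l]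
  have "fixed_point A v" "fixed_point A w"
    using lb nv unfolding fixed_point_def by blast+
  moreover have "sig h u \<noteq> -1" "sig h u = 0 \<longrightarrow> same_point v u \<or> same_point w u" if "fixed_point A u" for u
    using e that lb vw unfolding null_pair_def by blast+
  ultimately show ?thesis
    unfolding loxodromic_def using nv null_pair_not_same[OF vw] by blast
qed

lemma parabolic_basis_parabolic:
  assumes "parabolic_basis v w l k"
  shows "parabolic h A" "\<not> loxodromic h A"
proof -
  note pb = assms[unfolded parabolic_basis_def]
  have vw: "null_pair v w"
    using pb by blast
  note nv = null_pair_fixed[OF vw]
  have "l \<noteq> 0"
    using pb by auto
  then have l: "l \<noteq> l \<and> l * \<i> * of_real k = 0 \<or> l = l \<and> l * \<i> * of_real k \<noteq> 0"
    "l \<noteq> \<alpha> * \<beta>" "l \<noteq> \<alpha> * \<beta>"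
    using pb by auto
  note e = eigenvector_sig[OF null_pair_frame[OF vw] _ _ l]
  have v: "fixed_point A v"
    using pb nv unfolding fixed_point_def by blast
  have *: "sig h u \<noteq> -1" "sig h u = 0 \<longrightarrow> same_point v u" if "fixed_point A u" for u
    using e that pb vw l(1) unfolding null_pair_def by blast+
  show "parabolic h A"
    unfolding parabolic_def using v nv * by blast
  show "\<not> loxodromic h A"
  proof
    assume "loxodromic h A"
    then obtain x y where xy: "fixed_point A x" "sig h x = 0" "fixed_point A y" "sig h y = 0"
      and "\<not> same_point x y"
      unfolding loxodromic_def by blast
    moreover have "same_point v x" "same_point v y"
      using xy * by blast+
    then obtain a b where "a \<noteq> 0" "b \<noteq> 0" "x = a *s v" "y = b *s v"
      unfolding same_point_def by blast
    moreover have "same_point v v"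
      unfolding same_point_def by (intro exI[of _ 1]) simp
    ultimately show False
      using same_point_scale by blast
  qed
qed

lemma elliptic_basis_elliptic:
  assumes "elliptic_basis n m l \<mu>"
  shows "elliptic h A" "\<not> loxodromic h A"
proof -
  have "n \<noteq> 0" "h n n = -1" "A *v n = l *s n"
    using assms by (auto simp: elliptic_basis_def orthonormal_def h_zero_left)
  then have "fixed_point A n \<and> sig h n = -1"
    by (auto simp: fixed_point_def sig_def)
  then show "elliptic h A" "\<not> loxodromic h A"
    unfolding elliptic_def loxodromic_def by blast+
qed

section \<open>Bending subgroups in the three normal forms\<close>

definition flow :: "(real \<Rightarrow> cmat) \<Rightarrow> bool" where
  "flow B \<longleftrightarrow> (\<forall>s. isometry h (B s) \<and> B s *v c = c \<and> B s ** A = A ** B s \<and> B s ** B (- s) = mat 1)"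

text \<open>The prescribed images keep the Gram matrix of the frame, so each parameter
  \<open>s\<close> has its isometry; the family is obtained by choice.\<close>

lemma flow_ex:
  assumes "frame a b c"
    and "\<And>s. h (f s) (f s) = h a a" "\<And>s. h (g s) (g s) = h b b" "\<And>s. h (f s) (g s) = h a b"
      "\<And>s. h (f s) c = h a c" "\<And>s. h (g s) c = h b c"
  shows "\<exists>B :: real \<Rightarrow> cmat. \<forall>s. isometry h (B s) \<and> B s *v a = f s \<and> B s *v b = g s \<and> B s *v c = c"
proof -
  have "\<exists>M. isometry h M \<and> M *v a = f s \<and> M *v b = g s \<and> M *v c = c" for s
    using frame_isometry[OF assms(1), of "f s" "g s" c] assms by metis
  then show ?thesis
    by (intro choice allI)
qed

lemma flowI:
  assumes "frame a b c" "\<And>s. isometry h (B s)" "\<And>s. B s *v c = c"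
    "\<And>s. B s *v (A *v a) = A *v (B s *v a)" "\<And>s. B s *v (A *v b) = A *v (B s *v b)"
    "\<And>s. B s *v (B (- s) *v a) = a" "\<And>s. B s *v (B (- s) *v b) = b"
  shows "flow B"
  unfolding flow_def using assms(2,3)
  by (intro allI conjI frame_matrix_eqI[OF assms(1)])
    (simp_all add: A_c vector_scalar_commute assms flip: matrix_vector_mul_assoc)

lemma elliptic_bending:
  assumes "elliptic_basis n m l \<mu>"
  obtains B where "bending_subgroup h \<alpha> \<beta> p q B" "flow B"
    "\<And>s. B s *v n = cis (s / 2) *s n" "\<And>s. B s *v m = cis (- s / 2) *s m"
proof -
  note eb = assms[unfolded elliptic_basis_def]
  have nm: "orthonormal n m"
    using eb by blast
  note o = nm[unfolded orthonormal_def]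
  note fr = orthonormal_frame[OF nm]
  have u: "cis x * cnj (cis x) = 1" for x
    by (simp add: cis_cnj cis_mult)
  have "\<exists>B. \<forall>s. isometry h (B s) \<and> B s *v n = cis (s / 2) *s n \<and> B s *v m = cis (- s / 2) *s m \<and> B s *v c = c"
    by (rule flow_ex[OF fr])
      (use o u in \<open>simp_all add: h_simps mult.assoc[symmetric] mult.commute[of "cnj _"]\<close>)
  then obtain B where B: "\<And>s. isometry h (B s)" "\<And>s. B s *v n = cis (s / 2) *s n"
    "\<And>s. B s *v m = cis (- s / 2) *s m" "\<And>s. B s *v c = c"
    by metis
  have "flow B"
    by (rule flowI[OF fr B(1,4)])
      (use eb in \<open>simp_all add: B vector_scalar_commute vector_smult_assoc cis_mult mult.commute\<close>)
  moreover have "\<not> same_point n m"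
    using o by (auto simp: same_point_def h_simps)
  moreover have "n \<noteq> 0" "m \<noteq> 0"
    using o h_zero_left by (metis zero_neq_one neg_equal_0_iff_equal)+
  moreover have "cis (s / 2) = exp (\<i> * of_real s / 2)" "cis (- s / 2) = exp (- (\<i> * of_real s / 2))" for s
    by (simp_all add: cis_conv_exp)
  ultimately have "bending_subgroup h \<alpha> \<beta> p q B"
    using pp qq pq not_same_point noneuclidean_span polar_c elliptic_basis_elliptic[OF assms] B eb o
    unfolding bending_subgroup_def Let_def A_def[symmetric] fixed_point_def
    by (intro conjI exI[of _ c] disjI1 bexI[of _ n] bexI[of _ m]) (auto simp: span_iff)
  then show ?thesis
    using that B \<open>flow B\<close> by blast
qed

lemma loxodromic_bending:
  assumes "loxodromic_basis v w l \<mu>"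
  obtains B where "bending_subgroup h \<alpha> \<beta> p q B" "flow B"
    "\<And>s. B s *v v = exp (of_real s) *s v" "\<And>s. B s *v w = exp (- of_real s) *s w"
proof -
  note lb = assms[unfolded loxodromic_basis_def]
  have vw: "null_pair v w"
    using lb by blast
  note o = vw[unfolded null_pair_def]
  note fr = null_pair_frame[OF vw]
  have "\<exists>B. \<forall>s. isometry h (B s) \<and> B s *v v = exp (of_real s) *s v \<and> B s *v w = exp (- of_real s) *s w \<and> B s *v c = c"
    by (rule flow_ex[OF fr])
      (use o in \<open>simp_all add: h_simps exp_cnj exp_minus\<close>)
  then obtain B where B: "\<And>s. isometry h (B s)" "\<And>s. B s *v v = exp (of_real s) *s v"
    "\<And>s. B s *v w = exp (- of_real s) *s w" "\<And>s. B s *v c = c"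
    by metis
  have "flow B"
    by (rule flowI[OF fr B(1,4)])
      (use lb in \<open>simp_all add: B vector_scalar_commute vector_smult_assoc exp_minus mult.commute\<close>)
  moreover have "bending_subgroup h \<alpha> \<beta> p q B"
    using pp qq pq not_same_point noneuclidean_span polar_c loxodromic_basis_loxodromic[OF assms] B lb
      null_pair_not_same[OF vw] null_pair_fixed[OF vw]
    unfolding bending_subgroup_def Let_def A_def[symmetric] fixed_point_def
    by (intro conjI exI[of _ c] disjI2[OF disjI1] exI[of _ v] exI[of _ w]) auto
  ultimately show ?thesis
    using that B by blast
qed

text \<open>The image of \<open>w\<close> stays isotropic because the coefficient of
  \<open>v\<close> is imaginary, and the shear commutes with \<open>A\<close>, which is itself a
  multiple of such a shear on the line.\<close>

lemma parabolic_bending: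
  assumes "parabolic_basis v w l k"
  obtains B where "bending_subgroup h \<alpha> \<beta> p q B" "flow B"
    "\<And>s. B s *v v = v" "\<And>s. B s *v w = (\<i> * of_real s) *s v + w"
proof -
  note pb = assms[unfolded parabolic_basis_def]
  have vw: "null_pair v w"
    using pb by blast
  note o = vw[unfolded null_pair_def] null_pair_sym[OF vw]
  note fr = null_pair_frame[OF vw]
  have "\<exists>B. \<forall>s. isometry h (B s) \<and> B s *v v = v \<and> B s *v w = (\<i> * of_real s) *s v + w \<and> B s *v c = c"
    by (rule flow_ex[OF fr])
      (use o in \<open>simp_all add: h_simps\<close>)
  then obtain B where B: "\<And>s. isometry h (B s)" "\<And>s. B s *v v = v"
    "\<And>s. B s *v w = (\<i> * of_real s) *s v + w" "\<And>s. B s *v c = c"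
    by metis
  have "flow B"
    by (rule flowI[OF fr B(1,4)])
      (use pb in \<open>simp_all add: B matrix_vector_right_distrib vector_scalar_commute,
        simp_all add: matrix_vector_mult_diff_distrib vector_scalar_commute B vec_eq_iff algebra_simps\<close>)
  moreover have "h v w \<in> \<real>"
    using o by simp
  then have "bending_subgroup h \<alpha> \<beta> p q B"
    using pp qq pq not_same_point noneuclidean_span polar_c parabolic_basis_parabolic(1)[OF assms] B pb
      null_pair_not_same[OF vw] null_pair_fixed[OF vw] o
    unfolding bending_subgroup_def Let_def A_def[symmetric] fixed_point_def
    by (intro conjI exI[of _ c] disjI2 bexI[of _ v] bexI[of _ w]) (auto simp: span_iff)
  ultimately show ?thesis
    using that B by blast
qed

section \<open>Points of the line with equal invariants lie on one orbit of the flow\<close>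

lemma elliptic_slice:
  assumes eb: "elliptic_basis n m l \<mu>" and u: "h u c = 0" "h u' c = 0"
    and eq: "h (A *v u) u - \<alpha> * \<beta> * h u u = h (A *v u') u' - \<alpha> * \<beta> * h u' u'"
  obtains B s \<omega> where "bending_subgroup h \<alpha> \<beta> p q B" "flow B" "cmod \<omega> = 1" "B s *v u' = \<omega> *s u"
proof -
  note eb' = eb[unfolded elliptic_basis_def]
  have nm: "orthonormal n m"
    using eb' by blast
  note o = nm[unfolded orthonormal_def] orthonormal_sym[OF nm]
  obtain a b where ab: "u = a *s n + b *s m"
    using orthonormal_coords[OF nm u(1)] by metis
  obtain a' b' where ab': "u' = a' *s n + b' *s m"
    using orthonormal_coords[OF nm u(2)] by metis
  define X where "X = cmod a ^ 2 - cmod a' ^ 2"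
  define Y where "Y = cmod b ^ 2 - cmod b' ^ 2"
  have X: "of_real X = a * cnj a - a' * cnj a'" and Y: "of_real Y = b * cnj b - b' * cnj b'"
    by (simp_all add: X_def Y_def flip: complex_norm_square)
  have XY: "of_real X * (l - \<alpha> * \<beta>) = of_real Y * (\<mu> - \<alpha> * \<beta>)"
    using eq eb' o unfolding X Y
    by (simp add: ab ab' matrix_vector_right_distrib vector_scalar_commute h_simps algebra_simps)
  \<comment> \<open>Otherwise \<open>l\<close> and \<mu> would be collinear with
    \<open>\<alpha> * \<beta>\<close>, although these are three distinct points of the unit
    circle.\<close>
  have "X = 0"
  proof (rule ccontr)
    assume "X \<noteq> 0"
    then have "l - \<alpha> * \<beta> = of_real (Y / X) * (\<mu> - \<alpha> * \<beta>)"
      using XY by (simp add: field_simps)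
    moreover have "cmod (\<alpha> * \<beta>) = 1"
      using \<alpha> \<beta> by (simp add: norm_mult)
    ultimately show False
      using unit_circle_chord eb' by blast
  qed
  moreover have "Y = 0"
    using XY eb' \<open>X = 0\<close> by auto
  ultimately have "cmod a' = cmod a" "cmod b' = cmod b"
    by (simp_all add: X_def Y_def)
  then obtain x y where xy: "a' = cis x * a" "b' = cis y * b"
    using cmod_eq_rotate by metis
  obtain B where B: "bending_subgroup h \<alpha> \<beta> p q B" "flow B"
    "\<And>s. B s *v n = cis (s / 2) *s n" "\<And>s. B s *v m = cis (- s / 2) *s m"
    using elliptic_bending[OF eb] by metis
  \<comment> \<open>Bending by \<open>y - x\<close> replaces the phases \<open>x\<close> and
    \<open>y\<close> of the two coordinates by their mean.\<close>
  have "(y - x) / 2 + x = (x + y) / 2" "- (y - x) / 2 + y = (x + y) / 2"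
    by (simp_all add: field_simps)
  then have cc: "cis ((y - x) / 2) * cis x = cis ((x + y) / 2)" "cis (- (y - x) / 2) * cis y = cis ((x + y) / 2)"
    by (simp_all only: cis_mult)
  have "B (y - x) *v u' = (cis ((y - x) / 2) * cis x * a) *s n + (cis (- (y - x) / 2) * cis y * b) *s m"
    by (simp only: ab' xy matrix_vector_right_distrib vector_scalar_commute B vector_smult_assoc ac_simps)
  also have "\<dots> = cis ((x + y) / 2) *s u"
    by (simp only: cc) (simp add: ab vec_eq_iff algebra_simps)
  finally show ?thesis
    using that[of B "cis ((x + y) / 2)"] B by simp
qed

text \<open>The flow and the phases preserve \<open>a * cnj b\<close>, and the equation determines
  this number. Nonisotropy makes both coordinates nonzero, so its value leaves only a phase and the
  scaling by the flow.\<close>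

lemma loxodromic_slice:
  assumes lb: "loxodromic_basis v w l \<mu>" and u: "h u c = 0" "h u' c = 0" "h u u \<noteq> 0"
    and eq: "h (A *v u) u - \<alpha> * \<beta> * h u u = h (A *v u') u' - \<alpha> * \<beta> * h u' u'"
  obtains B s \<omega> where "bending_subgroup h \<alpha> \<beta> p q B" "flow B" "cmod \<omega> = 1" "B s *v u' = \<omega> *s u"
proof -
  note lb' = lb[unfolded loxodromic_basis_def]
  have vw: "null_pair v w"
    using lb' by blast
  note o = vw[unfolded null_pair_def] null_pair_sym[OF vw]
  obtain a b where ab: "u = a *s v + b *s w"
    using null_pair_coords[OF vw u(1)] by metis
  obtain a' b' where ab': "u' = a' *s v + b' *s w"
    using null_pair_coords[OF vw u(2)] by metis
  define z where "z = a * cnj b - a' * cnj b'"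
  have unit: "cmod (\<alpha> * \<beta>) = 1"
    using \<alpha> \<beta> by (simp add: norm_mult)
  have "(l - \<alpha> * \<beta>) * z + (\<mu> - \<alpha> * \<beta>) * cnj z = 0"
    using eq lb' o unfolding z_def
    by (simp add: ab ab' matrix_vector_right_distrib vector_scalar_commute h_simps algebra_simps)
  then have "(l - \<alpha> * \<beta>) * z = - ((\<mu> - \<alpha> * \<beta>) * cnj z)"
    by (simp add: eq_neg_iff_add_eq_0)
  then have "cmod (l - \<alpha> * \<beta>) * cmod z = cmod (\<mu> - \<alpha> * \<beta>) * cmod z"
    by (metis complex_mod_cnj norm_minus_cancel norm_mult)
  \<comment> \<open>\<open>l\<close> and \<mu> are inverse with respect to the unit circle, so their
    distances to the point \<open>\<alpha> * \<beta>\<close> of the circle have ratio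
    \<open>cmod l\<close>, which is not 1.\<close>
  moreover have "cmod (l - \<alpha> * \<beta>) \<noteq> cmod (\<mu> - \<alpha> * \<beta>)"
  proof -
    have "\<alpha> * \<beta> * cnj (\<alpha> * \<beta>) = 1"
      using unit by (metis complex_norm_square of_real_1 one_power2)
    then have "\<alpha> * \<beta> * cnj (l - \<alpha> * \<beta>) = - (cnj l * (\<mu> - \<alpha> * \<beta>)) + (cnj l * \<mu> - 1)"
      by (simp add: algebra_simps)
    moreover have "cnj l * \<mu> = 1"
      using lb' by (metis complex_cnj_cnj complex_cnj_mult complex_cnj_one)
    ultimately have "cmod (l - \<alpha> * \<beta>) = cmod l * cmod (\<mu> - \<alpha> * \<beta>)"
      using unit by (metis add.right_neutral complex_mod_cnj diff_self mult_1 norm_minus_cancel norm_mult)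
    moreover have "cmod (l - \<alpha> * \<beta>) \<noteq> 0"
      using unit lb' by auto
    ultimately show ?thesis
      using lb' by auto
  qed
  ultimately have "z = 0"
    by simp
  then have z: "a * cnj b = a' * cnj b'"
    by (simp add: z_def)
  have "h u u = a * cnj b + cnj (a * cnj b)"
    using o by (simp add: ab h_simps mult.commute)
  then have ab0: "a \<noteq> 0" "b \<noteq> 0"
    using u by auto
  then have ab0': "a' \<noteq> 0" "b' \<noteq> 0"
    using z by auto
  obtain B where B: "bending_subgroup h \<alpha> \<beta> p q B" "flow B"
    "\<And>s. B s *v v = exp (of_real s) *s v" "\<And>s. B s *v w = exp (- of_real s) *s w"
    using loxodromic_bending[OF lb] by metis
  \<comment> \<open>Flowing by \<open>ln r\<close> equates the moduli of the first coordinates, and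
    \<omega> is the remaining phase; \<open>z\<close> then forces the second coordinates to
    agree.\<close>
  define r where "r = cmod a / cmod a'"
  define \<omega> where "\<omega> = of_real r * a' / a"
  have r: "r > 0" "exp (complex_of_real (ln r)) = of_real r"
  proof -
    show "r > 0"
      using ab0 ab0' by (simp add: r_def)
    then show "exp (complex_of_real (ln r)) = of_real r"
      by (simp only: exp_of_real exp_ln)
  qed
  have \<omega>: "cmod \<omega> = 1"
    using ab0 ab0' by (simp add: \<omega>_def r_def norm_mult norm_divide)
  then have \<omega>': "\<omega> * cnj \<omega> = 1"
    by (simp flip: complex_norm_square)
  have "cnj b' = a * cnj b / a'"
    using z ab0' by (simp add: field_simps)
  then have "cnj \<omega> * (cnj b' / of_real r) = cnj \<omega> * (cnj b * (a / (of_real r * a')))"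
    by (simp add: field_simps)
  also have "a / (of_real r * a') = cnj \<omega>"
    using \<omega>' by (metis \<omega>_def inverse_divide inverse_unique)
  finally have "cnj \<omega> * (cnj b' / of_real r) = cnj \<omega> * (cnj b * cnj \<omega>)" .
  moreover have "cnj \<omega> \<noteq> 0"
    using \<omega> by auto
  ultimately have "cnj b' / of_real r = cnj b * cnj \<omega>"
    using mult_left_cancel by blast
  then have "cnj (b' / of_real r) = cnj (\<omega> * b)"
    by (simp add: mult.commute)
  then have b: "b' / of_real r = \<omega> * b"
    by (metis complex_cnj_cancel_iff)
  have a: "of_real r * a' = \<omega> * a"
    using ab0 by (simp add: \<omega>_def)
  have "B (ln r) *v u' = (of_real r * a') *s v + (b' / of_real r) *s w"
    using r(2) by (simp add: ab' matrix_vector_right_distrib vector_scalar_commute B exp_minus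
        vector_smult_assoc field_simps)
  also have "\<dots> = \<omega> *s u"
    by (simp only: a b) (simp add: ab vec_eq_iff algebra_simps)
  finally show ?thesis
    using that B \<omega> by blast
qed

text \<open>The invariants here are \<open>h u u\<close> and \<open>cmod b\<close>. Nonisotropy
  gives a nonzero \<open>b\<close>, which is what lets the shear move the first coordinate.\<close>

lemma parabolic_slice:
  assumes pb: "parabolic_basis v w l k" and u: "h u c = 0" "h u' c = 0" "h u u \<noteq> 0"
    and eq: "h (A *v u) u - \<alpha> * \<beta> * h u u = h (A *v u') u' - \<alpha> * \<beta> * h u' u'"
  obtains B s \<omega> where "bending_subgroup h \<alpha> \<beta> p q B" "flow B" "cmod \<omega> = 1" "B s *v u' = \<omega> *s u"
proof -
  note pb' = pb[unfolded parabolic_basis_def]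
  have vw: "null_pair v w"
    using pb' by blast
  note o = vw[unfolded null_pair_def] null_pair_sym[OF vw]
  obtain a b where ab: "u = a *s v + b *s w"
    using null_pair_coords[OF vw u(1)] by metis
  obtain a' b' where ab': "u' = a' *s v + b' *s w"
    using null_pair_coords[OF vw u(2)] by metis
  define X where "X = 2 * Re (a * cnj b) - 2 * Re (a' * cnj b')"
  define Y where "Y = cmod b ^ 2 - cmod b' ^ 2"
  have X: "of_real X = a * cnj b + b * cnj a - (a' * cnj b' + b' * cnj a')"
    by (simp add: X_def complex_eq_iff)
  have Y: "of_real Y = b * cnj b - b' * cnj b'"
    by (simp add: Y_def flip: complex_norm_square)
  have l: "l * cnj l = 1"
    using pb' by (simp flip: complex_norm_square)
  have "(l - \<alpha> * \<beta>) * of_real X + l * \<i> * of_real k * of_real Y = 0"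
    using eq pb' o unfolding X Y
    by (simp add: ab ab' matrix_vector_right_distrib vector_scalar_commute h_simps algebra_simps)
  then have "cnj l * ((l - \<alpha> * \<beta>) * of_real X + l * \<i> * of_real k * of_real Y) = 0"
    by simp
  moreover define g where "g = cnj l * (\<alpha> * \<beta>)"
  moreover have "cnj l * ((l - \<alpha> * \<beta>) * of_real X + l * \<i> * of_real k * of_real Y) =
      (l * cnj l - g) * of_real X + (l * cnj l) * \<i> * of_real k * of_real Y"
    by (simp add: g_def algebra_simps)
  ultimately have XY: "(1 - g) * of_real X + \<i> * of_real k * of_real Y = 0"
    by (simp add: l)
  have g: "cmod g = 1" "g \<noteq> 1"
  proof -
    show "cmod g = 1"
      using pb' \<alpha> \<beta> by (simp add: g_def norm_mult)
    show "g \<noteq> 1"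
      using l pb' by (metis g_def inverse_unique mult.commute mult_cancel_left right_inverse_eq zero_neq_one mult_eq_0_iff)
  qed
  \<comment> \<open>After division by \<open>l\<close> the second term of the equation is imaginary,
    so its real part involves only \<open>X\<close>, with factor \<open>1 - Re g\<close>.\<close>
  have "Re g \<noteq> 1"
  proof
    assume "Re g = 1"
    moreover have "Re g ^ 2 + Im g ^ 2 = 1"
      using g(1) by (metis cmod_power2 one_power2)
    ultimately show False
      using g(2) by (simp add: complex_eq_iff)
  qed
  moreover have "(1 - Re g) * X = 0"
    using XY by (simp add: complex_eq_iff)
  ultimately have X0: "X = 0"
    by simp
  then have "Y = 0"
    using XY pb' by simp
  then have "cmod b' = cmod b"
    by (simp add: Y_def)
  then obtain x where b': "b' = cis x * b"
    by (rule cmod_eq_rotate)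
  define \<omega> where "\<omega> = cis x"
  have \<omega>: "\<omega> * cnj \<omega> = 1"
    by (simp add: \<omega>_def cis_cnj cis_mult)
  have b: "b \<noteq> 0"
    using u(3) o by (auto simp: ab h_simps)
  define a'' where "a'' = cnj \<omega> * a'"
  have a'': "a' = \<omega> * a''"
    using \<omega> by (simp add: a''_def flip: mult.assoc)
  have "a' * cnj b' = (\<omega> * cnj \<omega>) * (a'' * cnj b)"
    by (simp add: a'' b' flip: \<omega>_def)
  then have "Re ((a - a'') * cnj b) = 0"
    using X0 by (simp add: X_def \<omega> left_diff_distrib)
  then have i: "(a - a'') * cnj b = \<i> * of_real (Im ((a - a'') * cnj b))"
    by (simp add: complex_eq_iff)
  \<comment> \<open>Equal norms make \<open>(a - a'') * cnj b\<close> imaginary, so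
    \<open>a - a''\<close> is an imaginary multiple of \<open>b\<close>; this is the shear
    parameter.\<close>
  define s where "s = Im ((a - a'') * cnj b) / cmod b ^ 2"
  have "complex_of_real (cmod b ^ 2) = b * cnj b"
    by (rule complex_norm_square)
  then have "\<i> * of_real s * b = (\<i> * of_real (Im ((a - a'') * cnj b))) * b / (b * cnj b)"
    by (simp add: s_def)
  also have "\<dots> = a - a''"
    using b unfolding i[symmetric] by simp
  finally have s: "a'' + \<i> * of_real s * b = a"
    by simp
  obtain B where B: "bending_subgroup h \<alpha> \<beta> p q B" "flow B"
    "\<And>s. B s *v v = v" "\<And>s. B s *v w = (\<i> * of_real s) *s v + w"
    using parabolic_bending[OF pb] by metis
  have "B s *v u' = (\<omega> * (a'' + \<i> * of_real s * b)) *s v + (\<omega> * b) *s w"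
    unfolding ab' a'' b' \<omega>_def[symmetric]
    by (simp add: matrix_vector_right_distrib vector_scalar_commute B) (simp add: vec_eq_iff algebra_simps)
  also have "\<dots> = \<omega> *s u"
    unfolding s by (simp add: ab vec_eq_iff algebra_simps)
  finally show ?thesis
    using that[of B \<omega> s] B by (simp add: \<omega>_def)
qed

text \<open>
  Nonisotropy of \<open>u\<close> cannot be dropped: a loxodromic flow keeps the two eigenlines apart, and a
  parabolic flow does not move the multiples of its eigenvector.
\<close>

lemma line_slice:
  assumes u: "h u c = 0" "h u' c = 0" "h u u \<noteq> 0"
    and eq: "h (A *v u) u - \<alpha> * \<beta> * h u u = h (A *v u') u' - \<alpha> * \<beta> * h u' u'"
  obtains B s \<omega> where "bending_subgroup h \<alpha> \<beta> p q B" "flow B" "cmod \<omega> = 1" "B s *v u' = \<omega> *s u"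
proof (cases rule: trichotomy)
  case (elliptic n m l \<mu>)
  then show ?thesis
    using elliptic_slice[OF _ u(1,2) eq] that by blast
next
  case (loxodromic v w l \<mu>)
  then show ?thesis
    using loxodromic_slice[OF _ u eq] that by blast
next
  case (parabolic v w l k)
  then show ?thesis
    using parabolic_slice[OF _ u eq] that by blast
qed

text \<open>Subtracting the part along \<open>c\<close> reduces the claim to
  \<open>line_slice\<close>. The flow matches the line parts up to a phase, and an isometry that
  fixes the line and rotates \<open>c\<close> corrects the rest.\<close>

lemma slice_transitive:
  assumes r: "h r r = h r' r'" "Re (h r r) < 0" and eq: "h (A *v r) r = h (A *v r') r'"
  obtains B s I \<omega> where "bending_subgroup h \<alpha> \<beta> p q B" "flow B"
    "isometry h I" "I *v p = p" "I *v q = q" "\<omega> \<noteq> 0" "I *v (B s *v r') = \<omega> *s r"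
proof -
  define u where "u = r - h r c *s c"
  define u' where "u' = r' - h r' c *s c"
  have u: "h u c = 0" "h u' c = 0"
    by (simp_all add: u_def u'_def h_simps c)
  have dec: "r = u + h r c *s c" "r' = u' + h r' c *s c"
    by (simp_all add: u_def u'_def)
  have norm: "h (x + k *s c) (x + k *s c) = h x x + k * cnj k"
    and A: "h (A *v (x + k *s c)) (x + k *s c) = h (A *v x) x + \<alpha> * \<beta> * (k * cnj k)"
    if "h x c = 0" for x k
    using that A_line[OF that] h_sym_zero[OF that] h_sym_zero[OF A_line[OF that]]
    by (simp_all add: h_simps c matrix_vector_right_distrib vector_scalar_commute A_c)
  note rs = norm[OF u(1), of "h r c"] norm[OF u(2), of "h r' c"]
    A[OF u(1), of "h r c"] A[OF u(2), of "h r' c"]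
  note rs = rs[folded dec]
  have eq': "h (A *v u) u - \<alpha> * \<beta> * h u u = h (A *v u') u' - \<alpha> * \<beta> * h u' u'"
    using r(1) eq unfolding rs by algebra
  \<comment> \<open>\<open>c\<close> is positive, so the line part is at least as negative as
    \<open>r\<close>; this is where the sign of \<open>r\<close> enters.\<close>
  have "Re (h u u) \<le> Re (h r r)"
    unfolding rs by (simp flip: complex_norm_square)
  then have "h u u \<noteq> 0"
    using r by auto
  then obtain B s \<omega> where B: "bending_subgroup h \<alpha> \<beta> p q B" "flow B" "cmod \<omega> = 1" "B s *v u' = \<omega> *s u"
    using line_slice[OF u _ eq'] by metis
  have Bs: "isometry h (B s)" "B s *v c = c"
    using B(2) by (auto simp: flow_def)
  have \<omega>: "\<omega> * cnj \<omega> = 1"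
    using B(3) by (simp flip: complex_norm_square)
  have "h u' u' = h (\<omega> *s u) (\<omega> *s u)"
    using Bs(1) B(4) unfolding isometry_def by metis
  also have "\<dots> = (\<omega> * cnj \<omega>) * h u u"
    by (simp add: h_simps)
  finally have "h u' u' = h u u"
    by (simp add: \<omega>)
  then have "h r c * cnj (h r c) = h r' c * cnj (h r' c)"
    using r(1) unfolding rs by simp
  then have "complex_of_real (cmod (h r c) ^ 2) = of_real (cmod (h r' c) ^ 2)"
    by (simp only: complex_norm_square)
  then have "cmod (h r c) = cmod (h r' c)"
    by (simp only: of_real_eq_iff) simp
  then obtain x where x: "h r c = cis x * h r' c"
    by (rule cmod_eq_rotate)
  \<comment> \<open>The rotation of \<open>c\<close> that makes both components of the bent
    \<open>r'\<close> carry the same phase \<omega> relative to \<open>r\<close>.\<close>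
  define \<phi> where "\<phi> = \<omega> * cis x"
  have "cis x * cnj (cis x) = 1"
    by (simp add: cis_cnj cis_mult)
  then have \<phi>: "\<phi> * cnj \<phi> = 1"
    using \<omega> by (simp add: \<phi>_def) (metis mult.commute mult.left_commute mult.right_neutral)
  have "h (\<phi> *s c) (\<phi> *s c) = h c c" "h p (\<phi> *s c) = h p c" "h q (\<phi> *s c) = h q c"
    using \<phi> by (simp_all add: h_simps c mult.commute)
  then obtain I where I: "isometry h I" "I *v p = p" "I *v q = q" "I *v c = \<phi> *s c"
    using frame_isometry[OF frame, of p q "\<phi> *s c"] by metis
  obtain i j where "u = i *s p + j *s q"
    using u(1) by (auto simp: mem_span2 simp flip: span_iff)
  then have Iu: "I *v u = u"
    by (simp add: matrix_vector_right_distrib vector_scalar_commute I)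
  have "I *v (B s *v r') = \<omega> *s u + (h r' c * \<phi>) *s c"
    by (subst dec) (simp add: matrix_vector_right_distrib vector_scalar_commute B(4) Bs I Iu)
  also have "\<dots> = \<omega> *s (u + h r c *s c)"
    by (simp add: \<phi>_def x vec_eq_iff algebra_simps)
  finally have "I *v (B s *v r') = \<omega> *s r"
    by (simp flip: dec)
  moreover have "\<omega> \<noteq> 0"
    using B(3) by auto
  ultimately show ?thesis
    using that B I by blast
qed

lemma loxodromic_slice_unbounded:
  assumes lox: "loxodromic h A" and x: "h x c = 0" "h x x \<noteq> 0" "h x r \<noteq> 0" "cmod (h x r) \<le> y"
  obtains B s where "bending_subgroup h \<alpha> \<beta> p q B" "flow B" "cmod (h (B s *v x) r) = y"
proof -
  obtain v w l \<mu> where lb: "loxodromic_basis v w l \<mu>"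
    using trichotomy parabolic_basis_parabolic(2) elliptic_basis_elliptic(2) lox by metis
  then have vw: "null_pair v w"
    by (simp add: loxodromic_basis_def)
  obtain a b where ab: "x = a *s v + b *s w"
    using null_pair_coords[OF vw x(1)] by metis
  obtain B where B: "bending_subgroup h \<alpha> \<beta> p q B" "flow B"
    "\<And>s. B s *v v = exp (of_real s) *s v" "\<And>s. B s *v w = exp (- of_real s) *s w"
    using loxodromic_bending[OF lb] by metis
  have "h (B s *v x) r = exp (of_real s) * (a * h v r) + exp (- of_real s) * (b * h w r)" for s
    by (simp add: ab matrix_vector_right_distrib vector_scalar_commute B h_simps algebra_simps)
  moreover have "h x r = a * h v r + b * h w r"
    by (simp add: ab h_simps)
  ultimately show ?thesis
    using exp_combination_unbounded[of "a * h v r" "b * h w r" y] x(3,4) that[OF B(1,2)] by metis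
qed

text \<open>The elliptic and the parabolic form both have an eigenvalue of modulus one on the line,
  which would bound the tance.\<close>

lemma loxodromic_large_tance:
  assumes "tance h p q > 4 / (cmod d1 * cmod d2)"
  shows "loxodromic h A"
proof -
  have "h q p = cnj (h p q)"
    by (rule h_cnj)
  then have "cmod t = tance h p q"
    by (simp add: t_def tance_def norm_divide norm_mult power2_eq_square)
  then have *: "cmod l \<noteq> 1" if "A *v v = l *s v" "h v c = 0" "v \<noteq> 0" for v l
    using eigenvalue_unit_bound[OF that] assms by auto
  show ?thesis
  proof (cases rule: trichotomy)
    case (elliptic n m l \<mu>)
    then have "n \<noteq> 0"
      by (auto simp: elliptic_basis_def orthonormal_def h_zero_left)
    then show ?thesis
      using * elliptic unfolding elliptic_basis_def orthonormal_def by blast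
  next
    case (loxodromic v w l \<mu>)
    then show ?thesis
      by (rule loxodromic_basis_loxodromic)
  next
    case (parabolic v w l k)
    then have "v \<noteq> 0"
      using null_pair_fixed unfolding parabolic_basis_def by blast
    then show ?thesis
      using * parabolic unfolding parabolic_basis_def null_pair_def by blast
  qed
qed

end

section \<open>Triples\<close>

lemma frameI_no_line:
  assumes "p1 \<noteq> 0" "p2 \<noteq> 0" "\<not> same_point p1 p2"
    and no_line: "\<not> (\<exists>L. complex_line L \<and> {p1, p2, p3} \<subseteq> L)"
  shows "frame p1 p2 p3"
proof -
  have indep: "i = 0 \<and> j = 0" if eq: "i *s p1 + j *s p2 = 0" for i j
  proof (rule ccontr)
    assume "\<not> (i = 0 \<and> j = 0)"
    then have ij: "i \<noteq> 0" "j \<noteq> 0"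
      using eq assms(1,2) by auto
    have "j *s p2 = (- i) *s p1"
      using eq by (simp add: eq_neg_iff_add_eq_0 add.commute)
    then have "p2 = (- i / j) *s p1"
      using ij by (metis divide_inverse mult.commute vector_smult_assoc vector_smult_lid right_inverse)
    then show False
      using assms(3) ij unfolding same_point_def by (metis divide_eq_0_iff neg_equal_0_iff_equal)
  qed
  have "p1 \<noteq> k *s p2" for k
    using indep[of 1 "- k"] by auto
  then have "p1 \<notin> vec.span {p2}" "p1 \<noteq> p2"
    by (auto simp: vec.span_singleton) (metis vector_smult_lid)
  then have "vec.independent {p1, p2}" "card {p1, p2} = 2"
    using assms(2) by (simp_all add: vec.independent_insert vec.dependent_single)
  then have "complex_line (vec.span {p1, p2})"
    by (metis complex_line_def vec.dim_span_eq_card_independent vec.subspace_span)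
  then have "p3 \<notin> vec.span {p1, p2}"
    using no_line vec.span_superset[of "{p1, p2}"] by blast
  then have p3: "p3 \<noteq> i *s p1 + j *s p2" for i j
    by (auto simp: mem_span2)
  show ?thesis
    unfolding frame_def
  proof (intro allI impI)
    fix i j k
    assume eq: "i *s p1 + j *s p2 + k *s p3 = 0"
    have "k = 0"
    proof (rule ccontr)
      assume "k \<noteq> 0"
      have "k *s p3 = - (i *s p1 + j *s p2)"
        using eq by (metis add.commute eq_neg_iff_add_eq_0)
      then have "inverse k *s (k *s p3) = inverse k *s - (i *s p1 + j *s p2)"
        by simp
      then have "p3 = (- i / k) *s p1 + (- j / k) *s p2"
        using \<open>k \<noteq> 0\<close> by (simp add: vec_eq_iff divide_inverse algebra_simps)
      then show False
        using p3 by blast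
    qed
    then show "i = 0 \<and> j = 0 \<and> k = 0"
      using eq indep by simp
  qed
qed

lemma act_act: "act I (k1, k2, k3) (act I' (l1, l2, l3) T) = act (I ** I') (k1 * l1, k2 * l2, k3 * l3) T"
  by (cases T) (simp add: vector_scalar_commute flip: matrix_vector_mul_assoc)

lemma act_id: "act (mat 1) (1, 1, 1) T = T"
  by (cases T) simp

context hermitian
begin

lemma tance_commute: "tance h p q = tance h q p"
  using h_cnj[of p q] by (simp add: tance_def mult.commute)

lemma tance_scale: "k \<noteq> 0 \<Longrightarrow> l \<noteq> 0 \<Longrightarrow> tance h (k *s p) (l *s q) = tance h p q"
  by (simp add: tance_def h_simps norm_mult power2_eq_square)

text \<open>Real factors adjust the norms, the tance then equates the moduli of the mixed products,
  and a phase on \<open>p'\<close> does the rest.\<close>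

lemma normalize_pair:
  assumes sig: "sig h p = sig h p'" "sig h q = sig h q'" "sig h p \<noteq> 0" "sig h q \<noteq> 0"
    and tance: "tance h p q = tance h p' q'"
  obtains k l where "k \<noteq> 0" "l \<noteq> 0" "h (k *s p') (k *s p') = h p p" "h (l *s q') (l *s q') = h q q"
    "h (k *s p') (l *s q') = h p q"
proof -
  have scale: "\<exists>k::real. k \<noteq> 0 \<and> h (of_real k *s y) (of_real k *s y) = h x x"
    if s: "sig h x = sig h y" "sig h x \<noteq> 0" for x y
  proof -
    have "Re (h x x) / Re (h y y) > 0" "Re (h x x) \<noteq> 0" "Re (h y y) \<noteq> 0"
      using s by (auto simp: sig_def sgn_if zero_less_divide_iff split: if_splits)
    moreover define k where "k = sqrt (Re (h x x) / Re (h y y))"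
    ultimately have k: "k \<noteq> 0" "k ^ 2 * Re (h y y) = Re (h x x)"
      by simp_all
    have "h (of_real k *s y) (of_real k *s y) = of_real (k ^ 2) * of_real (Re (h y y))"
      by (simp add: h_simps power2_eq_square flip: h_self)
    also have "\<dots> = h x x"
      unfolding of_real_mult[symmetric] k(2) by (rule h_self[symmetric])
    finally show ?thesis
      using k(1) by blast
  qed
  obtain k l :: real where kl: "k \<noteq> 0" "h (of_real k *s p') (of_real k *s p') = h p p"
    "l \<noteq> 0" "h (of_real l *s q') (of_real l *s q') = h q q"
    using scale[of p p'] scale[of q q'] sig by metis
  have "h p p \<noteq> 0" "h q q \<noteq> 0"
    using sig by (auto simp: sig_def)
  moreover have "tance h (of_real k *s p') (of_real l *s q') = tance h p q"
    using kl by (simp add: tance_scale tance)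
  ultimately have "cmod (h p q) ^ 2 = cmod (h (of_real k *s p') (of_real l *s q')) ^ 2"
    by (simp add: tance_def kl)
  then have "cmod (h p q) = cmod (h (of_real k *s p') (of_real l *s q'))"
    by (metis norm_ge_zero power2_eq_imp_eq)
  then obtain x where x: "h p q = cis x * h (of_real k *s p') (of_real l *s q')"
    by (rule cmod_eq_rotate)
  have "cis x * cnj (cis x) = 1"
    by (simp add: cis_cnj cis_mult)
  moreover have "h ((cis x * of_real k) *s p') ((cis x * of_real k) *s p') =
      (cis x * cnj (cis x)) * h (of_real k *s p') (of_real k *s p')"
    by (simp add: h_simps)
  ultimately have "h ((cis x * of_real k) *s p') ((cis x * of_real k) *s p') = h p p"
    by (simp add: kl)
  moreover have "h ((cis x * of_real k) *s p') (of_real l *s q') = h p q"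
    unfolding x by (simp add: h_simps)
  ultimately show ?thesis
    using kl by (intro that[of "cis x * of_real k" "of_real l"]) simp_all
qed

end

text \<open>One bending together with everything needed to apply it inside a triple: the product and
  the independence from a third point survive, and a bending of the new pair leads back.\<close>

definition pair_bending :: "form \<Rightarrow> complex \<Rightarrow> complex \<Rightarrow> cvec \<Rightarrow> cvec \<Rightarrow> cmat \<Rightarrow> bool" where
  "pair_bending h \<alpha> \<beta> p q M \<longleftrightarrow> isometry h M \<and>
     R h \<beta> (M *v q) ** R h \<alpha> (M *v p) = R h \<beta> q ** R h \<alpha> p \<and>
     (\<forall>r. frame p q r \<longrightarrow> frame (M *v p) (M *v q) r) \<and>
     (\<exists>B s. bending_subgroup h \<alpha> \<beta> p q B \<and> M = B s) \<and>
     (\<exists>B s. bending_subgroup h \<alpha> \<beta> (M *v p) (M *v q) B \<and> B s *v (M *v p) = p \<and> B s *v (M *v q) = q)"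

context hyperbolic_pair
begin

lemma flow_pair_bending:
  assumes B: "bending_subgroup h \<alpha> \<beta> p q B" "flow B"
  shows "pair_bending h \<alpha> \<beta> p q (B s)"
proof -
  have I: "isometry h (B s)" "B s ** B (- s) = mat 1" "B (- s) ** B s = mat 1"
    and BA: "B s ** A = A ** B s" and Bc: "B s *v c = c"
    using B(2) unfolding flow_def by (metis add.inverse_inverse)+
  have "R h \<beta> (B s *v q) ** R h \<alpha> (B s *v p) = B s ** A ** B (- s)"
    by (simp add: R_conj[OF I] A_def) (metis I(3) matrix_mul_assoc matrix_mul_rid)
  also have "\<dots> = A"
    by (simp add: BA I flip: matrix_mul_assoc)
  finally have R: "R h \<beta> (B s *v q) ** R h \<alpha> (B s *v p) = R h \<beta> q ** R h \<alpha> p"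
    by (simp add: A_def)
  have fr: "frame (B s *v p) (B s *v q) r" if r: "frame p q r" for r
    unfolding frame_def
  proof (intro allI impI)
    fix i j k
    assume eq: "i *s (B s *v p) + j *s (B s *v q) + k *s r = 0"
    have "h (B s *v p) c = 0" "h (B s *v q) c = 0"
      using I(1) Bc c unfolding isometry_def by metis+
    moreover have "h (i *s (B s *v p) + j *s (B s *v q) + k *s r) c = 0"
      by (simp add: eq h_zero_left)
    ultimately have "k = 0"
      using frame_perp_ne_0[OF r] by (simp add: h_simps)
    then have "B s *v (i *s p + j *s q) = 0"
      using eq by (simp add: matrix_vector_right_distrib vector_scalar_commute)
    then have "B (- s) *v (B s *v (i *s p + j *s q)) = 0"
      by simp
    then have "i *s p + j *s q + 0 *s r = 0"
      by (simp add: matrix_vector_mul_assoc I)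
    then show "i = 0 \<and> j = 0 \<and> k = 0"
      using r \<open>k = 0\<close> unfolding frame_def by blast
  qed
  \<comment> \<open>Conjugation by \<open>B s\<close> gives a bending subgroup of the moved pair;
    its parameter \<open>- s\<close> undoes the bending.\<close>
  have "bending_subgroup h \<alpha> \<beta> (B s *v p) (B s *v q) (\<lambda>t. B s ** B t ** B (- s))"
    using bending_subgroup_act[OF I, of 1 1] B(1) by simp
  moreover have "(B s ** B (- s) ** B (- s)) *v (B s *v x) = x" for x
    by (simp add: I matrix_vector_mul_assoc)
  ultimately have "\<exists>B' s'. bending_subgroup h \<alpha> \<beta> (B s *v p) (B s *v q) B' \<and>
      B' s' *v (B s *v p) = p \<and> B' s' *v (B s *v q) = q"
    by (intro exI[of _ "\<lambda>t. B s ** B t ** B (- s)"] exI[of _ "- s"]) simp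
  then show ?thesis
    unfolding pair_bending_def using I(1) R fr B(1) by blast
qed

text \<open>The norms of \<open>x\<close> and \<open>r\<close> stay fixed, so the tance
  \<open>y\<close> means that \<open>cmod (h x r)\<close> becomes \<open>sqrt (y * N)\<close>, a
  value that the loxodromic flow attains.\<close>

lemma pair_bending_raise:
  assumes "loxodromic h (R h \<beta> q ** R h \<alpha> p)" "x = p \<or> x = q" "h x r \<noteq> 0"
    and y: "tance h x r \<le> y" "h r r \<noteq> 0"
  obtains M where "pair_bending h \<alpha> \<beta> p q M" "tance h (M *v x) r = y" "h (M *v x) r \<noteq> 0"
proof -
  have x: "h x c = 0" "h x x \<noteq> 0"
    using assms(2) c pp qq by auto
  define N where "N = cmod (h x x) * cmod (h r r)"
  have N: "N > 0"
    using x y by (simp add: N_def)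
  have le: "cmod (h x r) ^ 2 \<le> y * N"
    using y(1) N unfolding tance_def N_def[symmetric] by (simp add: pos_divide_le_eq)
  then have "cmod (h x r) \<le> sqrt (y * N)"
    by (rule real_le_rsqrt)
  then obtain B s where B: "bending_subgroup h \<alpha> \<beta> p q B" "flow B"
    and eq: "cmod (h (B s *v x) r) = sqrt (y * N)"
    using loxodromic_slice_unbounded[OF _ x assms(3)] assms(1) unfolding A_def by metis
  have yN: "y * N > 0"
    using le assms(3) by (metis less_le_trans zero_less_norm_iff zero_less_power)
  then have "cmod (h (B s *v x) r) ^ 2 = y * N"
    by (simp add: eq)
  moreover have "h (B s *v x) (B s *v x) = h x x"
    using B(2) by (simp add: flow_def isometry_def)
  ultimately have "tance h (B s *v x) r = y"
    using N by (simp add: tance_def flip: N_def)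
  moreover have "h (B s *v x) r \<noteq> 0"
    using eq yN by auto
  ultimately show ?thesis
    using that flow_pair_bending[OF B] by blast
qed

end

context hermitian_ppm
begin

text \<open>Equal tances allow the second pair to be moved onto the first. Equal traces then place
  both third points on one slice, where the flow joins them; moving the third point by
  \<open>B s\<close> amounts, modulo isometry, to bending the pair by
  \<open>B (- s)\<close>.\<close>

lemma pair_transitive:
  assumes hyp: "hyperbolic_pair h \<alpha> \<beta> p q c" "hyperbolic_pair h \<alpha> \<beta> p' q' c'"
    and \<gamma>: "cmod \<gamma> = 1" "\<gamma> ^ 3 \<noteq> 1"
    and sig: "sig h p = sig h p'" "sig h q = sig h q'" "sig h r = -1" "sig h r' = -1"
    and tance: "tance h p q = tance h p' q'"
    and trace: "trace (R h \<gamma> r ** (R h \<beta> q ** R h \<alpha> p)) = trace (R h \<gamma> r' ** (R h \<beta> q' ** R h \<alpha> p'))"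
  obtains M N k1 k2 k3 where "pair_bending h \<alpha> \<beta> p q M" "isometry h N"
    "k1 \<noteq> 0" "k2 \<noteq> 0" "k3 \<noteq> 0"
    "M *v p = k1 *s (N *v p')" "M *v q = k2 *s (N *v q')" "r = k3 *s (N *v r')"
proof -
  interpret P: hyperbolic_pair h \<alpha> \<beta> p q c
    by (rule hyp)
  interpret P': hyperbolic_pair h \<alpha> \<beta> p' q' c'
    by (rule hyp)
  have ne0: "sig h p \<noteq> 0" "sig h q \<noteq> 0"
    using P.pp P.qq h_self[of p] h_self[of q] by (auto simp: sig_def sgn_if)
  obtain k l where kl: "k \<noteq> 0" "l \<noteq> 0" "h (k *s p') (k *s p') = h p p"
    "h (l *s q') (l *s q') = h q q" "h (k *s p') (l *s q') = h p q"
    using normalize_pair[OF sig(1,2) ne0 tance] by metis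
  \<comment> \<open>A single vector is normalised as the degenerate pair \<open>r\<close>,
    \<open>r\<close>.\<close>
  have "tance h r r = 1" "tance h r' r' = 1"
    using sig(3,4) by (auto simp: tance_def power2_eq_square sig_def sgn_if split: if_splits)
  then obtain m where m: "m \<noteq> 0" "h (m *s r') (m *s r') = h r r"
    using normalize_pair[of r r' r r'] sig by (metis zero_neq_neg_one)
  have fr: "frame (k *s p') (l *s q') c'"
    using P'.frame kl(1,2) unfolding frame_def vector_smult_assoc
    by (metis mult_eq_0_iff)
  obtain I where I: "isometry h I" "I *v (k *s p') = p" "I *v (l *s q') = q" "I *v c' = c"
    using frame_isometry[OF fr, of p q c] kl P.c P'.c by (auto simp: h_simps)
  obtain J where J: "I ** J = mat 1" "J ** I = mat 1" "isometry h J"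
    using isometry_inverse[OF I(1)] by metis
  define r'' where "r'' = I *v (m *s r')"
  have hr: "h r'' r'' = h r r"
    using I(1) m unfolding r''_def isometry_def by simp
  have R: "R h \<delta> (I *v (k *s x)) = I ** R h \<delta> x ** J" if "k \<noteq> 0" for \<delta> k x
    using R_conj[OF I(1) J(1,2)] R_scale that by simp
  have "R h \<gamma> r'' ** (R h \<beta> q ** R h \<alpha> p) =
      I ** R h \<gamma> r' ** (J ** I) ** R h \<beta> q' ** (J ** I) ** R h \<alpha> p' ** J"
    unfolding r''_def I(2,3)[symmetric] R[OF m(1)] R[OF kl(1)] R[OF kl(2)]
    by (simp only: matrix_mul_assoc)
  also have "\<dots> = I ** (R h \<gamma> r' ** (R h \<beta> q' ** R h \<alpha> p') ** J)"
    by (simp add: J matrix_mul_assoc)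
  finally have "trace (R h \<gamma> r'' ** (R h \<beta> q ** R h \<alpha> p)) =
      trace (R h \<gamma> r' ** (R h \<beta> q' ** R h \<alpha> p') ** (J ** I))"
    by (metis matrix_mul_assoc trace_mul_sym)
  then have tr: "trace (R h \<gamma> r'' ** P.A) = trace (R h \<gamma> r ** P.A)"
    by (simp add: J trace P.A_def)
  have hrr: "Re (h r r) < 0"
    using sig(3) by (auto simp: sig_def sgn_if split: if_splits)
  have "inverse \<gamma> ^ 2 - \<gamma> \<noteq> 0"
  proof -
    have "\<gamma> \<noteq> 0"
      using \<gamma> by auto
    then show ?thesis
      using \<gamma>(2) by (auto simp: field_simps power2_eq_square power3_eq_cube)
  qed
  then have "h (P.A *v r'') r'' = h (P.A *v r) r"
    using tr hrr hr unfolding trace_R_mult by auto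
  then obtain B s I' \<omega> where B: "bending_subgroup h \<alpha> \<beta> p q B" "P.flow B"
    and I': "isometry h I'" "I' *v p = p" "I' *v q = q"
    and \<omega>: "\<omega> \<noteq> 0" "I' *v (B s *v r) = \<omega> *s r''"
    using P.slice_transitive[of r'' r] hr hrr by metis
  obtain J' where J': "I' ** J' = mat 1" "J' ** I' = mat 1" "isometry h J'"
    using isometry_inverse[OF I'(1)] by metis
  have Bs: "B (- s) ** B s = mat 1" "isometry h (B (- s))"
    using B(2) unfolding P.flow_def by (metis add.inverse_inverse)+
  \<comment> \<open>Undoes the isometry \<open>I'\<close> and the flow after the normalisation
    \<open>I\<close>, so that the third point returns to \<open>r\<close> and the pair appears
    bent.\<close>
  define N where "N = B (- s) ** J' ** I"
  have J'p: "J' *v p = p" "J' *v q = q"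
    using I' J'(2) by (metis matrix_vector_mul_assoc matrix_vector_mul_lid)+
  have "r = B (- s) *v (J' *v (I' *v (B s *v r)))"
    by (metis Bs(1) J'(2) matrix_vector_mul_assoc matrix_vector_mul_lid)
  also have "\<dots> = (\<omega> * m) *s (N *v r')"
    by (simp add: \<omega> r''_def N_def vector_scalar_commute flip: matrix_vector_mul_assoc)
  finally have r: "r = (\<omega> * m) *s (N *v r')" .
  have "N *v (k *s p') = B (- s) *v p" "N *v (l *s q') = B (- s) *v q"
    unfolding N_def by (simp_all only: matrix_vector_mul_assoc[symmetric] I J'p)
  then have pq: "B (- s) *v p = k *s (N *v p')" "B (- s) *v q = l *s (N *v q')"
    by (simp_all add: vector_scalar_commute)
  have "isometry h N"
    unfolding N_def using Bs J' I by (intro isometry_mult)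
  with P.flow_pair_bending[OF B, of "- s"] show ?thesis
    using kl m \<omega> by (intro that[OF _ _ _ _ _ pq r]) auto
qed

end

text \<open>The combinatorial core, stated abstractly because it is used twice, with the roles of
  the two tances exchanged.\<close>

lemma common_level:
  fixes X Y :: "'a \<Rightarrow> real"
  assumes trans: "\<And>S T U. conn S T \<Longrightarrow> conn T U \<Longrightarrow> conn S U"
    and sym: "\<And>S T. conn S T \<Longrightarrow> conn T S"
    and raise_Y: "\<And>T y. G T \<Longrightarrow> L T \<Longrightarrow> Y T \<le> y \<Longrightarrow> \<exists>S. G S \<and> conn T S \<and> Y S = y"
    and raise_X: "\<And>T x. G T \<Longrightarrow> L' T \<Longrightarrow> X T \<le> x \<Longrightarrow> \<exists>S. G S \<and> conn T S \<and> X S = x"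
    and large: "\<And>T. G T \<Longrightarrow> X T > K \<Longrightarrow> L T"
    and level: "\<And>S T. G S \<Longrightarrow> G T \<Longrightarrow> Y S = Y T \<Longrightarrow> conn S T"
    and T: "G T" "L T \<or> L' T" and T': "G T'" "L T' \<or> L' T'"
  shows "conn T T'"
proof -
  have up: "\<exists>y0. \<forall>y\<ge>y0. \<exists>S. G S \<and> conn T S \<and> Y S = y" if T: "G T" "L T \<or> L' T" for T
  proof (cases "L T")
    case True
    then show ?thesis
      using raise_Y T by blast
  next
    case False
    \<comment> \<open>The target is at least the current value, so that it can be reached, and
      exceeds \<open>K\<close>, so that \<open>large\<close> yields \<open>L S\<close>.\<close>
    then obtain S where S: "G S" "conn T S" "X S = max (X T) (K + 1)"
      using raise_X[of T "max (X T) (K + 1)"] T by auto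
    then have "L S"
      using large[of S] by auto
    then show ?thesis
      using raise_Y[of S] S trans by metis
  qed
  obtain y0 y1 where "\<forall>y\<ge>y0. \<exists>S. G S \<and> conn T S \<and> Y S = y" "\<forall>y\<ge>y1. \<exists>S. G S \<and> conn T' S \<and> Y S = y"
    using up[OF T] up[OF T'] by blast
  then obtain S S' where "G S" "conn T S" "Y S = max y0 y1" "G S'" "conn T' S'" "Y S' = max y0 y1"
    by (metis max.cobounded1 max.cobounded2)
  then show ?thesis
    using level[of S S'] trans sym by metis
qed

section \<open>Regular triples modulo isometries and rescaling\<close>

locale triple_data = hermitian_ppm +
  fixes \<alpha>1 \<alpha>2 \<alpha>3 \<tau> :: complex and \<sigma>1 \<sigma>2 \<sigma>3 :: real
  assumes \<alpha>: "cmod \<alpha>1 = 1" "\<alpha>1 ^ 3 \<noteq> 1" "cmod \<alpha>2 = 1" "\<alpha>2 ^ 3 \<noteq> 1" "cmod \<alpha>3 = 1" "\<alpha>3 ^ 3 \<noteq> 1"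
    and \<sigma>: "\<sigma>1 \<in> {-1, 1}" "\<sigma>2 \<in> {-1, 1}" "\<sigma>3 \<in> {-1, 1}"
      "\<not> (\<sigma>1 = 1 \<and> \<sigma>2 = 1)" "\<not> (\<sigma>1 = 1 \<and> \<sigma>3 = 1)" "\<not> (\<sigma>2 = 1 \<and> \<sigma>3 = 1)"
begin

text \<open>Strong regularity in linear terms: \<open>frame\<close> stands for distinct points off a
  common line, and the nonzero signs make the points nonisotropic.\<close>

fun regular :: "triple \<Rightarrow> bool" where
  "regular (p1, p2, p3) \<longleftrightarrow> sig h p1 = \<sigma>1 \<and> sig h p2 = \<sigma>2 \<and> sig h p3 = \<sigma>3 \<and>
     frame p1 p2 p3 \<and> h p2 p1 \<noteq> 0 \<and> h p2 p3 \<noteq> 0 \<and>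
     trace (R h \<alpha>3 p3 ** R h \<alpha>2 p2 ** R h \<alpha>1 p1) = \<tau>"

fun lox12 :: "triple \<Rightarrow> bool" where
  "lox12 (p1, p2, p3) \<longleftrightarrow> loxodromic h (R h \<alpha>2 p2 ** R h \<alpha>1 p1)"

fun lox23 :: "triple \<Rightarrow> bool" where
  "lox23 (p1, p2, p3) \<longleftrightarrow> loxodromic h (R h \<alpha>3 p3 ** R h \<alpha>2 p2)"

fun tance12 :: "triple \<Rightarrow> real" where
  "tance12 (p1, p2, p3) = tance h p2 p1"

fun tance23 :: "triple \<Rightarrow> real" where
  "tance23 (p1, p2, p3) = tance h p2 p3"

text \<open>Bendings that can be undone by a bending, so that connectedness becomes
  symmetric.\<close>

definition step :: "triple \<Rightarrow> triple \<Rightarrow> bool" where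
  "step T S \<longleftrightarrow> bending h (\<alpha>1, \<alpha>2, \<alpha>3) T S \<and> bending h (\<alpha>1, \<alpha>2, \<alpha>3) S T"

definition conn :: "triple \<Rightarrow> triple \<Rightarrow> bool" where
  "conn T S \<longleftrightarrow> (\<exists>I k1 k2 k3. isometry h I \<and> k1 \<noteq> 0 \<and> k2 \<noteq> 0 \<and> k3 \<noteq> 0 \<and>
     step\<^sup>*\<^sup>* T (act I (k1, k2, k3) S))"

lemma steps_sym: "step\<^sup>*\<^sup>* T S \<Longrightarrow> step\<^sup>*\<^sup>* S T"
  by (rule sympD[OF symp_rtranclp]) (auto simp: symp_def step_def)

lemma steps_act:
  assumes "step\<^sup>*\<^sup>* T S" "isometry h I" "k1 \<noteq> 0" "k2 \<noteq> 0" "k3 \<noteq> 0"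
  shows "step\<^sup>*\<^sup>* (act I (k1, k2, k3) T) (act I (k1, k2, k3) S)"
  using assms(1)
proof induction
  case (step S U)
  then have "step (act I (k1, k2, k3) S) (act I (k1, k2, k3) U)"
    using assms(2-) by (auto simp: step_def intro: bending_act)
  then show ?case
    using step by simp
qed simp

lemma conn_trans:
  assumes "conn T S" "conn S U"
  shows "conn T U"
proof -
  obtain I k1 k2 k3 where I: "isometry h I" "k1 \<noteq> 0" "k2 \<noteq> 0" "k3 \<noteq> 0"
    "step\<^sup>*\<^sup>* T (act I (k1, k2, k3) S)"
    using assms(1) unfolding conn_def by blast
  obtain J l1 l2 l3 where J: "isometry h J" "l1 \<noteq> 0" "l2 \<noteq> 0" "l3 \<noteq> 0"
    "step\<^sup>*\<^sup>* S (act J (l1, l2, l3) U)"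
    using assms(2) unfolding conn_def by blast
  have "step\<^sup>*\<^sup>* T (act (I ** J) (k1 * l1, k2 * l2, k3 * l3) U)"
    using I(5) steps_act[OF J(5) I(1-4)] by (simp add: act_act)
  then show ?thesis
    unfolding conn_def using I J isometry_mult by (metis mult_eq_0_iff)
qed

lemma conn_sym:
  assumes "conn T S"
  shows "conn S T"
proof -
  obtain I k1 k2 k3 where I: "isometry h I" "k1 \<noteq> 0" "k2 \<noteq> 0" "k3 \<noteq> 0"
    "step\<^sup>*\<^sup>* T (act I (k1, k2, k3) S)"
    using assms unfolding conn_def by blast
  obtain J where J: "isometry h J" "J ** I = mat 1"
    using isometry_inverse[OF I(1)] by metis
  have "step\<^sup>*\<^sup>* (act J (inverse k1, inverse k2, inverse k3) (act I (k1, k2, k3) S))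
      (act J (inverse k1, inverse k2, inverse k3) T)"
    using steps_act[OF steps_sym[OF I(5)] J(1)] I(2-4) by simp
  then have "step\<^sup>*\<^sup>* S (act J (inverse k1, inverse k2, inverse k3) T)"
    using I(2-4) J(2) by (simp only: act_act) (simp add: act_id)
  then show ?thesis
    unfolding conn_def using I(2-4) J(1) by (metis inverse_nonzero_iff_nonzero)
qed

lemma step_act_conn:
  assumes "step T (act I (k1, k2, k3) S)" "isometry h I" "k1 \<noteq> 0" "k2 \<noteq> 0" "k3 \<noteq> 0"
  shows "conn T S"
  unfolding conn_def using assms by blast

lemma isometry_id: "isometry h (mat 1)"
  by (simp add: isometry_def)

lemma step_conn: "step T S \<Longrightarrow> conn T S"
  using step_act_conn[of T "mat 1" 1 1 1 S] by (simp add: act_id isometry_id)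

lemma step12: "pair_bending h \<alpha>1 \<alpha>2 p1 p2 M \<Longrightarrow> step (p1, p2, p3) (M *v p1, M *v p2, p3)"
  unfolding pair_bending_def step_def by (metis bending.bend12)

lemma step23: "pair_bending h \<alpha>2 \<alpha>3 p2 p3 M \<Longrightarrow> step (p1, p2, p3) (p1, M *v p2, M *v p3)"
  unfolding pair_bending_def step_def by (metis bending.bend23)

lemma regular_nonisotropic:
  assumes "regular (p1, p2, p3)"
  shows "h p1 p1 \<noteq> 0" "h p2 p2 \<noteq> 0" "h p3 p3 \<noteq> 0"
  using assms \<sigma>(1-3) by (auto simp: sig_def)

lemma regular_pair12:
  assumes "regular (p1, p2, p3)"
  obtains c where "hyperbolic_pair h \<alpha>1 \<alpha>2 p1 p2 c"
proof -
  have "sig h p1 = -1 \<or> sig h p2 = -1"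
    using assms \<sigma> by auto
  then have "Re (h p1 p1) < 0 \<or> Re (h p2 p2) < 0"
    by (auto simp: sig_def sgn_if split: if_splits)
  moreover have "h p1 p2 \<noteq> 0"
    using assms h_sym_zero by auto
  ultimately show ?thesis
    using that hyperbolic_pairI[OF \<alpha>(1-4), of p1 p2 p3] assms regular_nonisotropic[OF assms] by auto
qed

lemma regular_pair23:
  assumes "regular (p1, p2, p3)"
  obtains c where "hyperbolic_pair h \<alpha>2 \<alpha>3 p2 p3 c"
proof -
  have "sig h p2 = -1 \<or> sig h p3 = -1"
    using assms \<sigma> by auto
  then have "Re (h p2 p2) < 0 \<or> Re (h p3 p3) < 0"
    by (auto simp: sig_def sgn_if split: if_splits)
  moreover have "frame p2 p3 p1"
    using assms frame_rotate by auto
  ultimately show ?thesis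
    using that hyperbolic_pairI[OF \<alpha>(3-6), of p2 p3 p1] assms regular_nonisotropic[OF assms] by auto
qed

text \<open>Bending \<open>p1\<close> and \<open>p2\<close> keeps their product, and with it the
  trace of the triple, while \<open>p2\<close> moves relative to \<open>p3\<close>.\<close>

lemma raise_tance23:
  assumes T: "regular T" "lox12 T" "tance23 T \<le> y"
  shows "\<exists>S. regular S \<and> conn T S \<and> tance23 S = y"
proof -
  obtain p1 p2 p3 where T': "T = (p1, p2, p3)"
    by (cases T)
  note reg = T(1)[unfolded T']
  obtain c where "hyperbolic_pair h \<alpha>1 \<alpha>2 p1 p2 c"
    using reg by (rule regular_pair12)
  then interpret hyperbolic_pair h \<alpha>1 \<alpha>2 p1 p2 c .
  have "loxodromic h (R h \<alpha>2 p2 ** R h \<alpha>1 p1)" "h p2 p3 \<noteq> 0" "tance h p2 p3 \<le> y"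
    using T by (simp_all add: T')
  then obtain M where M: "pair_bending h \<alpha>1 \<alpha>2 p1 p2 M" "tance h (M *v p2) p3 = y" "h (M *v p2) p3 \<noteq> 0"
    using pair_bending_raise[of p2 p3 y] regular_nonisotropic[OF reg] by blast
  have "regular (M *v p1, M *v p2, p3)"
    using reg M unfolding pair_bending_def isometry_def
    by (simp add: sig_def flip: matrix_mul_assoc)
  then show ?thesis
    using step_conn[OF step12[OF M(1)]] M(2) T' by auto
qed

lemma raise_tance12:
  assumes T: "regular T" "lox23 T" "tance12 T \<le> y"
  shows "\<exists>S. regular S \<and> conn T S \<and> tance12 S = y"
proof -
  obtain p1 p2 p3 where T': "T = (p1, p2, p3)"
    by (cases T)
  note reg = T(1)[unfolded T']
  obtain c where "hyperbolic_pair h \<alpha>2 \<alpha>3 p2 p3 c"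
    using reg by (rule regular_pair23)
  then interpret hyperbolic_pair h \<alpha>2 \<alpha>3 p2 p3 c .
  have "loxodromic h (R h \<alpha>3 p3 ** R h \<alpha>2 p2)" "h p2 p1 \<noteq> 0" "tance h p2 p1 \<le> y"
    using T by (simp_all add: T')
  then obtain M where M: "pair_bending h \<alpha>2 \<alpha>3 p2 p3 M" "tance h (M *v p2) p1 = y" "h (M *v p2) p1 \<noteq> 0"
    using pair_bending_raise[of p2 p1 y] regular_nonisotropic[OF reg] by blast
  have "frame p2 p3 p1"
    using reg frame_rotate by simp
  then have "frame (M *v p2) (M *v p3) p1"
    using M(1) unfolding pair_bending_def by blast
  then have "frame p1 (M *v p2) (M *v p3)"
    using frame_rotate by blast
  then have "regular (p1, M *v p2, M *v p3)"
    using reg M unfolding pair_bending_def isometry_def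
    by (simp add: sig_def)
  then show ?thesis
    using step_conn[OF step23[OF M(1)]] M(2) T' by auto
qed

lemma large_tance12:
  assumes "regular T" "tance12 T > 4 / (cmod (inverse \<alpha>1 ^ 2 - \<alpha>1) * cmod (inverse \<alpha>2 ^ 2 - \<alpha>2))"
  shows "lox12 T"
proof -
  obtain p1 p2 p3 where T: "T = (p1, p2, p3)"
    by (cases T)
  obtain c where "hyperbolic_pair h \<alpha>1 \<alpha>2 p1 p2 c"
    using assms(1)[unfolded T] by (rule regular_pair12)
  then interpret hyperbolic_pair h \<alpha>1 \<alpha>2 p1 p2 c .
  show ?thesis
    using loxodromic_large_tance assms(2) by (simp add: T A_def d1_def d2_def tance_commute[of p2])
qed

lemma large_tance23:
  assumes "regular T" "tance23 T > 4 / (cmod (inverse \<alpha>2 ^ 2 - \<alpha>2) * cmod (inverse \<alpha>3 ^ 2 - \<alpha>3))"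
  shows "lox23 T"
proof -
  obtain p1 p2 p3 where T: "T = (p1, p2, p3)"
    by (cases T)
  obtain c where "hyperbolic_pair h \<alpha>2 \<alpha>3 p2 p3 c"
    using assms(1)[unfolded T] by (rule regular_pair23)
  then interpret hyperbolic_pair h \<alpha>2 \<alpha>3 p2 p3 c .
  show ?thesis
    using loxodromic_large_tance assms(2) by (simp add: T A_def d1_def d2_def)
qed

text \<open>The pairs agree up to isometry by their tance, and a negative third point makes the
  slice a single orbit.\<close>

lemma level12:
  assumes "regular S" "regular T" "tance12 S = tance12 T" "\<sigma>3 = -1"
  shows "conn S T"
proof -
  obtain p1 p2 p3 where S: "S = (p1, p2, p3)"
    by (cases S)
  obtain q1 q2 q3 where T: "T = (q1, q2, q3)"
    by (cases T)
  note reg = assms(1)[unfolded S regular.simps] assms(2)[unfolded T regular.simps]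
  obtain c where c: "hyperbolic_pair h \<alpha>1 \<alpha>2 p1 p2 c"
    using assms(1)[unfolded S] by (rule regular_pair12)
  obtain c' where c': "hyperbolic_pair h \<alpha>1 \<alpha>2 q1 q2 c'"
    using assms(2)[unfolded T] by (rule regular_pair12)
  obtain M N k1 k2 k3 where "pair_bending h \<alpha>1 \<alpha>2 p1 p2 M" "isometry h N"
    "k1 \<noteq> 0" "k2 \<noteq> 0" "k3 \<noteq> 0"
    "M *v p1 = k1 *s (N *v q1)" "M *v p2 = k2 *s (N *v q2)" "p3 = k3 *s (N *v q3)"
    by (rule pair_transitive[OF c c' \<alpha>(5,6), of p3 q3])
      (use reg assms(3,4) in \<open>simp_all add: S T matrix_mul_assoc tance_commute[of p1] tance_commute[of q1]\<close>)
  then show ?thesis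
    using step12[of p1 p2 M p3] step_act_conn[of S N k1 k2 k3 T] by (simp add: S T)
qed

lemma level23:
  assumes "regular S" "regular T" "tance23 S = tance23 T" "\<sigma>1 = -1"
  shows "conn S T"
proof -
  obtain p1 p2 p3 where S: "S = (p1, p2, p3)"
    by (cases S)
  obtain q1 q2 q3 where T: "T = (q1, q2, q3)"
    by (cases T)
  note reg = assms(1)[unfolded S regular.simps] assms(2)[unfolded T regular.simps]
  obtain c where c: "hyperbolic_pair h \<alpha>2 \<alpha>3 p2 p3 c"
    using assms(1)[unfolded S] by (rule regular_pair23)
  obtain c' where c': "hyperbolic_pair h \<alpha>2 \<alpha>3 q2 q3 c'"
    using assms(2)[unfolded T] by (rule regular_pair23)
  \<comment> \<open>By cyclicity of the trace, \<open>p1\<close> takes the part of the third point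
    for the pair \<open>p2\<close>, \<open>p3\<close>.\<close>
  obtain M N k1 k2 k3 where "pair_bending h \<alpha>2 \<alpha>3 p2 p3 M" "isometry h N"
    "k1 \<noteq> 0" "k2 \<noteq> 0" "k3 \<noteq> 0"
    "M *v p2 = k1 *s (N *v q2)" "M *v p3 = k2 *s (N *v q3)" "p1 = k3 *s (N *v q1)"
    by (rule pair_transitive[OF c c' \<alpha>(1,2), of p1 q1])
      (use reg assms(3,4) in \<open>simp_all add: S T trace_mul_sym[of "R h \<alpha>1 _"]\<close>)
  then show ?thesis
    using step23[of p2 p3 M p1] step_act_conn[of S N k3 k1 k2 T] by (simp add: S T)
qed

lemma regular_connected:
  assumes "regular S" "lox12 S \<or> lox23 S" "regular T" "lox12 T \<or> lox23 T"
  shows "conn S T"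
proof (cases "\<sigma>1 = -1")
  case True
  show ?thesis
  proof (rule common_level[where G = regular and L = lox12 and L' = lox23 and Y = tance23 and X = tance12])
    show "conn S U" if "conn S T" "conn T U" for S T U
      using that by (rule conn_trans)
    show "conn T S" if "conn S T" for S T
      using that by (rule conn_sym)
    show "\<exists>S. regular S \<and> conn T S \<and> tance23 S = y" if "regular T" "lox12 T" "tance23 T \<le> y" for T y
      using that by (rule raise_tance23)
    show "\<exists>S. regular S \<and> conn T S \<and> tance12 S = x" if "regular T" "lox23 T" "tance12 T \<le> x" for T x
      using that by (rule raise_tance12)
    show "conn S T" if "regular S" "regular T" "tance23 S = tance23 T" for S T
      using that True by (rule level23)
  qed (use assms in \<open>auto intro: large_tance12\<close>)
next
  case False
  \<comment> \<open>At most one sign is positive, so a positive first point leaves a negative last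
    one.\<close>
  then have \<sigma>3: "\<sigma>3 = -1"
    using \<sigma> by auto
  show ?thesis
  proof (rule common_level[where G = regular and L = lox23 and L' = lox12 and Y = tance12 and X = tance23])
    show "conn S U" if "conn S T" "conn T U" for S T U
      using that by (rule conn_trans)
    show "conn T S" if "conn S T" for S T
      using that by (rule conn_sym)
    show "\<exists>S. regular S \<and> conn T S \<and> tance12 S = y" if "regular T" "lox23 T" "tance12 T \<le> y" for T y
      using that by (rule raise_tance12)
    show "\<exists>S. regular S \<and> conn T S \<and> tance23 S = x" if "regular T" "lox12 T" "tance23 T \<le> x" for T x
      using that by (rule raise_tance23)
    show "conn S T" if "regular S" "regular T" "tance12 S = tance12 T" for S T
      using that \<sigma>3 by (rule level12)
  qed (use assms in \<open>auto intro: large_tance23\<close>)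
qed

text \<open>The isometry is rescaled into \<open>SU h\<close>; the scalar is absorbed because points
  are compared only by \<open>same_point\<close>.\<close>

lemma conn_connected_by_bendings:
  assumes "conn S T"
  shows "connected_by_bendings h (\<alpha>1, \<alpha>2, \<alpha>3) S T"
proof -
  obtain I k1 k2 k3 where I: "isometry h I" "k1 \<noteq> 0" "k2 \<noteq> 0" "k3 \<noteq> 0"
    "step\<^sup>*\<^sup>* S (act I (k1, k2, k3) T)"
    using assms unfolding conn_def by blast
  obtain q1 q2 q3 where T: "T = (q1, q2, q3)"
    by (cases T)
  obtain J k where J: "J \<in> SU h" "k \<noteq> 0" "\<And>x. J *v x = k *s (I *v x)"
    using isometry_SU[OF I(1)] by metis
  have "same_point (J *v x) (l *s (I *v x))" if "l \<noteq> 0" for l x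
    unfolding same_point_def J(3) using that J(2) by (intro exI[of _ "l / k"]) simp
  moreover have "(bending h (\<alpha>1, \<alpha>2, \<alpha>3))\<^sup>*\<^sup>* S (act I (k1, k2, k3) T)"
    using I(5) by (rule rtranclp_mono[THEN predicate2D, rotated]) (auto simp: step_def)
  ultimately show ?thesis
    unfolding connected_by_bendings_def T act.simps prod.case using I(2-4) J(1) by blast
qed

end

theorem corollary5p11:
  fixes h :: form
    and \<alpha>1 \<alpha>2 \<alpha>3 \<tau> :: complex
    and \<sigma>1 \<sigma>2 \<sigma>3 :: real
    and p1 p2 p3 q1 q2 q3 :: cvec
  assumes "hermitian_form h" and "signature_ppm h"
    and "\<alpha>1 \<in> sphere 0 1 - \<Omega>" and "\<alpha>2 \<in> sphere 0 1 - \<Omega>" and "\<alpha>3 \<in> sphere 0 1 - \<Omega>"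
    and "\<sigma>1 \<in> {-1, 1}" and "\<sigma>2 \<in> {-1, 1}" and "\<sigma>3 \<in> {-1, 1}"
    and "\<not> (\<sigma>1 = 1 \<and> \<sigma>2 = 1)" and "\<not> (\<sigma>1 = 1 \<and> \<sigma>3 = 1)" and "\<not> (\<sigma>2 = 1 \<and> \<sigma>3 = 1)"
    and "strongly_regular h (\<alpha>1, \<alpha>2, \<alpha>3) (\<sigma>1, \<sigma>2, \<sigma>3) \<tau> (p1, p2, p3)"
    and "strongly_regular h (\<alpha>1, \<alpha>2, \<alpha>3) (\<sigma>1, \<sigma>2, \<sigma>3) \<tau> (q1, q2, q3)"
    and "SU_conjugate h (R h \<alpha>3 p3 ** R h \<alpha>2 p2 ** R h \<alpha>1 p1)
                        (R h \<alpha>3 q3 ** R h \<alpha>2 q2 ** R h \<alpha>1 q1)"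
    and "loxodromic h (R h \<alpha>3 p3 ** R h \<alpha>2 p2) \<or> loxodromic h (R h \<alpha>2 p2 ** R h \<alpha>1 p1)"
    and "loxodromic h (R h \<alpha>3 q3 ** R h \<alpha>2 q2) \<or> loxodromic h (R h \<alpha>2 q2 ** R h \<alpha>1 q1)"
  shows "connected_by_bendings h (\<alpha>1, \<alpha>2, \<alpha>3) (p1, p2, p3) (q1, q2, q3)"
proof -
  interpret triple_data h \<alpha>1 \<alpha>2 \<alpha>3 \<tau> \<sigma>1 \<sigma>2 \<sigma>3
    using assms(1-11) by unfold_locales (auto simp: \<Omega>_def)
  have "regular (r1, r2, r3)"
    if r: "strongly_regular h (\<alpha>1, \<alpha>2, \<alpha>3) (\<sigma>1, \<sigma>2, \<sigma>3) \<tau> (r1, r2, r3)" for r1 r2 r3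
  proof -
    have nz: "r1 \<noteq> 0" "r2 \<noteq> 0" and "\<not> same_point r1 r2"
      "\<not> (\<exists>L. complex_line L \<and> {r1, r2, r3} \<subseteq> L)"
      using r h_zero_left unfolding strongly_regular_def prod.case by metis+
    then have "frame r1 r2 r3"
      by (rule frameI_no_line)
    then show ?thesis
      using r by (simp add: strongly_regular_def)
  qed
  then have "conn (p1, p2, p3) (q1, q2, q3)"
    using assms(12,13,15,16) by (intro regular_connected) auto
  then show ?thesis
    by (rule conn_connected_by_bendings)
qed

end
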